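(* Let $N\ge 2$, $\mathcal V=\{1,\dots,N\}$, and let $f_i:\mathbb R^N\to\mathbb R$, $i\in\mathcal V$, be the objective functions of an $N$-player game in which player $i$ chooses $x_i\in\mathbb R$ to minimize $f_i(\mathbf x)$, $\mathbf x=[x_1,\dots,x_N]^T$. Suppose that: (i) each $f_i$ is twice-continuously differentiable; (ii) for each $i\in\mathcal V$ there is a constant $l_i>0$ with $\|\nabla_i f_i(\mathbf x)-\nabla_i f_i(\mathbf z)\|\le l_i\|\mathbf x-\mathbf z\|$ for all $\mathbf x,\mathbf z\in\mathbb R^N$; (iii) there is a constant $m>0$ with $(\mathbf x-\mathbf z)^T(\mathcal P(\mathbf x)-\mathcal P(\mathbf z))\ge m\|\mathbf x-\mathbf z\|^2$ for all $\mathbf x,\mathbf z\in\mathbb R^N$, where $\mathcal P(\mathbf x)=[\nabla_1f_1(\mathbf x),\dots,\nabla_Nf_N(\mathbf x)]^T$; (iv) $\mathcal G$ is an undirected connected graph on the vertex set $\mathcal V$ without self-loops, with $0$-$1$ adjacency matrix $[a_{ij}]$. Consider the system in the real variables $x_i$, $y_{ij}$, $c_{ij}$, $\bar c_{ij}$ ($i,j\in\mathcal V$) $$\dot x_i=-\nabla_i f_i(\mathbf y_i),$$ $$\dot y_{ij}=-\Big(\sum_{k=1}^N a_{ik}c_{ik}(y_{ij}-y_{kj})+a_{ij}\bar c_{ij}(y_{ij}-x_j)\Big),$$ $$\dot c_{ij}=a_{ij}(\mathbf y_i-\mathbf y_j)^T(\mathbf y_i-\mathbf y_j),$$ $$\dot{\bar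 c}_{ij}=a_{ij}(y_{ij}-x_j)^2,$$ where $\mathbf y_i=[y_{i1},\dots,y_{iN}]^T$, $\mathbf y=[\mathbf y_1^T,\dots,\mathbf y_N^T]^T$, and the initial conditions satisfy $c_{ij}(0)=c_{ji}(0)$ for all $i,j\in\mathcal V$. Let $\mathbf x^*$ be the Nash equilibrium of the game. Then: 1. the Nash equilibrium $\mathbf x^*$ is globally asymptotically stable (in the sense specified in the context); 2. for every such initial condition, $\|\mathbf y(t)-\mathbf 1_N\otimes\mathbf x(t)\|\to 0$ as $t\to\infty$; 3. for every such initial condition, the adaptive gains $c_{ij}(t)$ and $\bar c_{ij}(t)$ converge to some finite values as $t\to\infty$, for all $i,j\in\mathcal V$.
   Context: $\nabla_i f_i(\mathbf z)$ denotes the partial derivative $\partial f_i(\mathbf x)/\partial x_i$ evaluated at $\mathbf x=\mathbf z$. $\|\cdot\|$ is the Euclidean norm, $\mathbf 1_N$ is the $N$-dimensional column vector of ones, $\otimes$ is the Kronecker product (so $\mathbf 1_N\otimes\mathbf x$ stacks $N$ copies of $\mathbf x$). The adjacency matrix has $a_{ij}=1$ if $(j,i)$ is an edge and $a_{ij}=0$ otherwise; undirected means $a_{ij}=a_{ji}$; no self-loops means $a_{ii}=0$; connected means there is a path between any two vertices. An action profile $\mathbf x^*=(x_i^*,\mathbf x_{-i}^* )$ is a Nash equilibrium if $f_i(x_i^*,\mathbf x_{-i}^* )\le f_i(x_i,\mathbf x_{-i}^* )$ for all $x_i\in\mathbb R$ and $i\in\mathcal V$, where $\mathbf x_{-i}=[x_1,\dots,x_{i-1},x_{i+1},\dots,x_N]^T$.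 Under hypotheses (i)-(iii) the Nash equilibrium exists, is unique, and is the unique solution of $\mathcal P(\mathbf x^* )=\mathbf 0_N$. Meaning of "globally asymptotically stable" for $\mathbf x^*$ under this adaptive system, with initial conditions restricted to those having $c_{ij}(0)=c_{ji}(0)$ for all $i,j$ and otherwise arbitrary real entries: (a) for every such initial condition the solution exists for all $t\ge 0$ and $\mathbf x(t)\to\mathbf x^*$ as $t\to\infty$; and (b) for all sufficiently large constants $c^*$, the equilibrium point $\mathbf x=\mathbf x^*$, $\mathbf y=\mathbf 1_N\otimes\mathbf x^*$, $c_{ij}=\bar c_{ij}=c^*$ ($i,j\in\mathcal V$) is stable in the sense of Lyapunov. *)

theory Defs
  imports "HOL-Analysis.Analysis"
begin

section \<open>Games\<close>

text \<open>The finite type \<open>'n\<close> is the set of players, so that \<open>N = CARD('n)\<close>.\<close>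

definition deviate :: "real ^ 'n \<Rightarrow> 'n \<Rightarrow> real \<Rightarrow> real ^ 'n::finite" where
  "deviate x i s = (\<chi> j. if j = i then s else x $ j)"

definition partial_derivative :: "'n \<Rightarrow> (real ^ 'n \<Rightarrow> real) \<Rightarrow> real ^ 'n::finite \<Rightarrow> real" where
  "partial_derivative i g z = deriv (\<lambda>s. g (deviate z i s)) (z $ i)"

definition twice_continuously_differentiable :: "('a::real_normed_vector \<Rightarrow> real) \<Rightarrow> bool" where
  "twice_continuously_differentiable g \<longleftrightarrow>
     (\<exists>(g' :: 'a \<Rightarrow> 'a \<Rightarrow>\<^sub>L real) (g'' :: 'a \<Rightarrow> 'a \<Rightarrow>\<^sub>L 'a \<Rightarrow>\<^sub>L real).
        (\<forall>x. (g has_derivative blinfun_apply (g' x)) (at x)) \<and>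
        (\<forall>x. (g' has_derivative blinfun_apply (g'' x)) (at x)) \<and>
        continuous_on UNIV g'')"

definition pseudo_gradient :: "('n \<Rightarrow> real ^ 'n \<Rightarrow> real) \<Rightarrow> real ^ 'n \<Rightarrow> real ^ 'n::finite" where
  "pseudo_gradient f x = (\<chi> i. partial_derivative i (f i) x)"

definition nash_equilibrium :: "('n \<Rightarrow> real ^ 'n \<Rightarrow> real) \<Rightarrow> real ^ 'n::finite \<Rightarrow> bool" where
  "nash_equilibrium f x \<longleftrightarrow> (\<forall>i s. f i x \<le> f i (deviate x i s))"


section \<open>Autonomous differential equations\<close>

definition solves_ivp ::
    "('a::real_normed_vector \<Rightarrow> 'a) \<Rightarrow> 'a \<Rightarrow> (real \<Rightarrow> 'a) \<Rightarrow> real set \<Rightarrow> bool" where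
  "solves_ivp F z0 z T \<longleftrightarrow>
     z 0 = z0 \<and> (\<forall>t\<in>T. (z has_vector_derivative F (z t)) (at t within T))"

text \<open>The solution from \<open>z0\<close> exists for all nonnegative times and is \<open>z\<close>: every solution, even
  one on a bounded time interval only, is a restriction of \<open>z\<close>.\<close>

definition is_global_solution ::
    "('a::real_normed_vector \<Rightarrow> 'a) \<Rightarrow> 'a \<Rightarrow> (real \<Rightarrow> 'a) \<Rightarrow> bool" where
  "is_global_solution F z0 z \<longleftrightarrow>
     solves_ivp F z0 z {0..} \<and>
     (\<forall>T>0. \<forall>w. solves_ivp F z0 w {0..<T} \<longrightarrow> (\<forall>t\<in>{0..<T}. w t = z t))"

text \<open>Lyapunov stability of an equilibrium point, for initial conditions restricted to \<open>S\<close>.\<close>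

definition lyapunov_stable ::
    "('a::real_normed_vector \<Rightarrow> 'a) \<Rightarrow> 'a set \<Rightarrow> 'a \<Rightarrow> bool" where
  "lyapunov_stable F S p \<longleftrightarrow>
     F p = 0 \<and>
     (\<forall>\<epsilon>>0. \<exists>\<delta>>0. \<forall>z0\<in>S. norm (z0 - p) < \<delta> \<longrightarrow>
        (\<exists>z. is_global_solution F z0 z \<and> (\<forall>t\<ge>0. norm (z t - p) < \<epsilon>)))"


section \<open>The adaptive Nash equilibrium seeking dynamics\<close>

definition adjacency :: "('n \<times> 'n) set \<Rightarrow> 'n \<Rightarrow> 'n \<Rightarrow> real" where
  "adjacency E i j = (if (j, i) \<in> E then 1 else 0)"

text \<open>A state is a quadruple \<open>(x, y, c, cb)\<close>, where \<open>cb\<close> holds the gains written with a bar, and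
  row \<open>y $ i\<close> is player \<open>i\<close>'s estimate of the action profile. The norms on \<open>real ^ 'n ^ 'n\<close> and on
  products are the Euclidean norms of the stacked entries.\<close>

type_synonym 'n state = "(real ^ 'n) \<times> (real ^ 'n ^ 'n) \<times> (real ^ 'n ^ 'n) \<times> (real ^ 'n ^ 'n)"

definition seeking_dynamics ::
    "('n \<Rightarrow> real ^ 'n \<Rightarrow> real) \<Rightarrow> ('n \<times> 'n) set \<Rightarrow> 'n::finite state \<Rightarrow> 'n state" where
  "seeking_dynamics f E = (\<lambda>(x, y, c, cb).
     (\<chi> i. - partial_derivative i (f i) (y $ i),
      \<chi> i j. - ((\<Sum>k\<in>UNIV. adjacency E i k * c $ i $ k * (y $ i $ j - y $ k $ j))
                 + adjacency E i j * cb $ i $ j * (y $ i $ j - x $ j)),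
      \<chi> i j. adjacency E i j * ((y $ i - y $ j) \<bullet> (y $ i - y $ j)),
      \<chi> i j. adjacency E i j * (y $ i $ j - x $ j)\<^sup>2))"

definition admissible_initial_states :: "'n::finite state set" where
  "admissible_initial_states = {(x, y, c, cb). \<forall>i j. c $ i $ j = c $ j $ i}"

definition replicate_profile :: "real ^ 'n \<Rightarrow> real ^ 'n ^ 'n::finite" where
  "replicate_profile x = (\<chi> i. x)"

definition equilibrium_state :: "real ^ 'n \<Rightarrow> real \<Rightarrow> 'n::finite state" where
  "equilibrium_state xs cs = (xs, replicate_profile xs, \<chi> i j. cs, \<chi> i j. cs)"

definition globally_asymptotically_stable ::
    "('n \<Rightarrow> real ^ 'n \<Rightarrow> real) \<Rightarrow> ('n \<times> 'n) set \<Rightarrow> real ^ 'n::finite \<Rightarrow> bool" where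
  "globally_asymptotically_stable f E xs \<longleftrightarrow>
     (\<forall>z0\<in>admissible_initial_states.
        \<exists>z. is_global_solution (seeking_dynamics f E) z0 z \<and>
            ((\<lambda>t. fst (z t)) \<longlongrightarrow> xs) at_top) \<and>
     (\<forall>\<^sub>F cs in at_top.
        lyapunov_stable (seeking_dynamics f E) admissible_initial_states (equilibrium_state xs cs))"

end

theory Submission
  imports Defs
begin

text \<open>
  Write \<open>e = y - replicate_profile x\<close> for the estimation error. The proof rests on the function
  \<open>lyapunov xs cs\<close>, half the sum of the squared norms of \<open>x - xs\<close> and \<open>e\<close> plus the weighted squared
  distances of the gains from a constant \<open>cs\<close>. The adaptive laws are made so that the actual gains
  cancel from its derivative (lemma \<open>coupling_power\<close>): the estimates are damped as if every gain were
  \<open>cs\<close>. Connectedness makes this damping coercive in \<open>e\<close> (\<open>disagreement_coercive\<close>), strong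
  monotonicity damps \<open>x - xs\<close>, and the terms mixing the two are dominated once \<open>cs\<close> is large
  (\<open>lyapunov_rate_le\<close>). So the function decreases at a rate of at least \<open>m / 2\<close> times
  \<open>tracking_error\<close>, the squared norm of \<open>x - xs\<close> plus that of \<open>e\<close>.

  As the function is comparable to the squared distance from the equilibrium with gains \<open>cs\<close>, its
  monotonicity bounds that distance by a fixed multiple of the initial one (\<open>a_priori_bound\<close>). This
  is Lyapunov stability, and it also excludes blow-up, so that solutions of the locally Lipschitz
  system exist globally (\<open>global_solution_of_a_priori_bound\<close>). Since the tracking error is dissipated
  and its slope is bounded, it tends to \<open>0\<close> (\<open>tendsto_zero_of_dissipation\<close>), which is convergence of
  both \<open>x\<close> and \<open>y\<close>. The gains are monotone and bounded, and therefore converge.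
\<close>

section \<open>Maps that are Lipschitz on every ball\<close>

text \<open>This is local Lipschitz continuity in the form that finite-dimensional vector fields need:
  one constant for all states below a given norm. It is stable under products, unlike a global
  Lipschitz bound, and so holds for fields that are built from globally Lipschitz maps by
  polynomial operations.\<close>

definition lipschitz_on_balls :: "('a::real_normed_vector \<Rightarrow> 'b::real_normed_vector) \<Rightarrow> bool" where
  "lipschitz_on_balls F \<longleftrightarrow> (\<forall>R. \<exists>L. L-lipschitz_on (cball 0 R) F)"

lemma lipschitz_on_ballsE:
  assumes "lipschitz_on_balls F"
  obtains L where "L > 0" "L-lipschitz_on (cball 0 R) F"
proof -
  obtain L where L: "L-lipschitz_on (cball 0 R) F"
    using assms by (auto simp: lipschitz_on_balls_def)
  have "(max L 1)-lipschitz_on (cball 0 R) F"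
    by (rule lipschitz_on_mono[OF L]) auto
  then show ?thesis by (intro that[of "max L 1"]) auto
qed

lemma lipschitz_on_balls_bounded:
  assumes "lipschitz_on_balls F"
  obtains M where "M > 0" "\<And>p. norm p \<le> R \<Longrightarrow> norm (F p) \<le> M"
proof -
  obtain L where L: "L > 0" "L-lipschitz_on (cball 0 R) F"
    using assms by (rule lipschitz_on_ballsE)
  have "norm (F p) \<le> norm (F 0) + L * \<bar>R\<bar> + 1" if "norm p \<le> R" for p
  proof -
    have "norm (F p - F 0) \<le> L * norm (p - 0)"
      by (rule lipschitz_on_normD[OF L(2)]) (use that order_trans[OF norm_ge_zero that] in simp_all)
    also have "\<dots> \<le> L * \<bar>R\<bar>" using that L(1) by (intro mult_left_mono) auto
    finally show ?thesis using norm_triangle_ineq2[of "F p" "F 0"] by linarith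
  qed
  moreover have "norm (F 0) + L * \<bar>R\<bar> + 1 > 0" using L(1) by (intro add_nonneg_pos add_nonneg_nonneg) auto
  ultimately show ?thesis by (rule that[rotated])
qed

lemma lipschitz_on_balls_bounded_linear:
  assumes "bounded_linear F"
  shows "lipschitz_on_balls F"
proof -
  obtain B where "B-lipschitz_on UNIV F"
    using bounded_linear.lipschitz_boundE[OF assms] by metis
  then show ?thesis
    unfolding lipschitz_on_balls_def by (meson lipschitz_on_subset subset_UNIV)
qed

lemma lipschitz_on_balls_const: "lipschitz_on_balls (\<lambda>p. k)"
  unfolding lipschitz_on_balls_def using lipschitz_on_constant by blast

lemma lipschitz_on_balls_add:
  assumes "lipschitz_on_balls F" "lipschitz_on_balls G"
  shows "lipschitz_on_balls (\<lambda>p. F p + G p)"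
  using assms unfolding lipschitz_on_balls_def by (blast intro: lipschitz_on_add)

lemma lipschitz_on_balls_minus:
  assumes "lipschitz_on_balls F"
  shows "lipschitz_on_balls (\<lambda>p. - F p)"
  using assms unfolding lipschitz_on_balls_def by (blast intro: lipschitz_on_minus)

lemma lipschitz_on_balls_diff:
  assumes "lipschitz_on_balls F" "lipschitz_on_balls G"
  shows "lipschitz_on_balls (\<lambda>p. F p - G p)"
  using assms unfolding lipschitz_on_balls_def by (blast intro: lipschitz_on_diff)

lemma lipschitz_on_balls_Pair:
  assumes "lipschitz_on_balls F" "lipschitz_on_balls G"
  shows "lipschitz_on_balls (\<lambda>p. (F p, G p))"
  using assms unfolding lipschitz_on_balls_def by (blast intro: lipschitz_on_Pair)

lemma lipschitz_on_balls_sum: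
  assumes "\<And>i. i \<in> I \<Longrightarrow> lipschitz_on_balls (F i)"
  shows "lipschitz_on_balls (\<lambda>p. \<Sum>i\<in>I. F i p)"
  using assms
  by (induction I rule: infinite_finite_induct)
    (auto intro: lipschitz_on_balls_add lipschitz_on_balls_const)

lemma lipschitz_on_balls_lipschitz_compose:
  assumes "lipschitz_on_balls F" "C-lipschitz_on UNIV G"
  shows "lipschitz_on_balls (\<lambda>p. G (F p))"
  unfolding lipschitz_on_balls_def
proof
  fix R
  obtain L where "L-lipschitz_on (cball 0 R) F"
    using assms(1) by (auto simp: lipschitz_on_balls_def)
  then have "(C * L)-lipschitz_on (cball 0 R) (\<lambda>p. G (F p))"
    using lipschitz_on_compose2[of L "cball 0 R" F C G] lipschitz_on_subset[OF assms(2)] by auto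
  then show "\<exists>L. L-lipschitz_on (cball 0 R) (\<lambda>p. G (F p))" ..
qed

lemma lipschitz_on_balls_linear_compose:
  assumes "bounded_linear G" "lipschitz_on_balls F"
  shows "lipschitz_on_balls (\<lambda>p. G (F p))"
proof -
  obtain B where "B-lipschitz_on UNIV G"
    using bounded_linear.lipschitz_boundE[OF assms(1)] by metis
  then show ?thesis by (rule lipschitz_on_balls_lipschitz_compose[OF assms(2)])
qed

lemma lipschitz_on_balls_vec_lambda:
  assumes "\<And>i. lipschitz_on_balls (F i)"
  shows "lipschitz_on_balls (\<lambda>p. \<chi> i. F i p)"
  unfolding lipschitz_on_balls_def
proof
  fix R
  have "\<forall>i. \<exists>L. L-lipschitz_on (cball 0 R) (F i)"
    using assms by (simp add: lipschitz_on_balls_def)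
  then obtain L where L: "\<And>i. (L i)-lipschitz_on (cball 0 R) (F i)"
    by (metis choice)
  have "(\<Sum>i\<in>UNIV. L i)-lipschitz_on (cball 0 R) (\<lambda>p. \<chi> i. F i p)"
  proof (rule lipschitz_onI)
    fix p q :: 'b assume pq: "p \<in> cball 0 R" "q \<in> cball 0 R"
    have "dist (\<chi> i. F i p) (\<chi> i. F i q) \<le> (\<Sum>i\<in>UNIV. dist (F i p) (F i q))"
      unfolding dist_vec_def by (rule order_trans[OF L2_set_le_sum]) auto
    also have "\<dots> \<le> (\<Sum>i\<in>UNIV. L i * dist p q)"
      using lipschitz_onD[OF L] pq by (intro sum_mono) auto
    finally show "dist (\<chi> i. F i p) (\<chi> i. F i q) \<le> (\<Sum>i\<in>UNIV. L i) * dist p q"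
      by (simp add: sum_distrib_right)
  qed (use lipschitz_on_nonneg[OF L] in \<open>auto intro: sum_nonneg\<close>)
  then show "\<exists>L. L-lipschitz_on (cball 0 R) (\<lambda>p. \<chi> i. F i p)" ..
qed

lemma (in bounded_bilinear) lipschitz_on_balls_bilinear:
  fixes F :: "'d::real_normed_vector \<Rightarrow> 'a" and G :: "'d \<Rightarrow> 'b"
  assumes "lipschitz_on_balls F" "lipschitz_on_balls G"
  shows "lipschitz_on_balls (\<lambda>p. prod (F p) (G p))"
  unfolding lipschitz_on_balls_def
proof
  fix R
  obtain K where K: "K > 0" "\<And>a b. norm (prod a b) \<le> norm a * norm b * K"
    using pos_bounded by blast
  obtain L where L: "L > 0" "L-lipschitz_on (cball 0 R) F"
    using assms(1) by (rule lipschitz_on_ballsE)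
  obtain L' where L': "L' > 0" "L'-lipschitz_on (cball 0 R) G"
    using assms(2) by (rule lipschitz_on_ballsE)
  obtain M where M: "M > 0" "\<And>p. norm p \<le> R \<Longrightarrow> norm (F p) \<le> M"
    using lipschitz_on_balls_bounded[OF assms(1)] by blast
  obtain M' where M': "M' > 0" "\<And>p. norm p \<le> R \<Longrightarrow> norm (G p) \<le> M'"
    using lipschitz_on_balls_bounded[OF assms(2)] by blast
  have "(L * M' * K + M * L' * K)-lipschitz_on (cball 0 R) (\<lambda>p. prod (F p) (G p))"
  proof (rule lipschitz_onI)
    fix p q :: 'd assume pq: "p \<in> cball 0 R" "q \<in> cball 0 R"
    have "prod (F p) (G p) - prod (F q) (G q) = prod (F p - F q) (G p) + prod (F q) (G p - G q)"
      by (simp add: diff_left diff_right)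
    then have "norm (prod (F p) (G p) - prod (F q) (G q))
        \<le> norm (F p - F q) * norm (G p) * K + norm (F q) * norm (G p - G q) * K"
      using norm_triangle_ineq[of "prod (F p - F q) (G p)" "prod (F q) (G p - G q)"]
        K(2)[of "F p - F q" "G p"] K(2)[of "F q" "G p - G q"] by simp
    also have "\<dots> \<le> (L * dist p q) * M' * K + M * (L' * dist p q) * K"
      using pq K(1) L(1) L'(1) M(1) M'(1) M(2)[of q] M'(2)[of p]
        lipschitz_onD[OF L(2) pq] lipschitz_onD[OF L'(2) pq]
      by (intro add_mono mult_right_mono mult_mono) (auto simp: dist_norm)
    finally show "dist (prod (F p) (G p)) (prod (F q) (G q))
        \<le> (L * M' * K + M * L' * K) * dist p q"
      by (simp add: dist_norm algebra_simps)
  qed (use K L L' M M' in auto)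
  then show "\<exists>L. L-lipschitz_on (cball 0 R) (\<lambda>p. prod (F p) (G p))" ..
qed

lemmas lipschitz_on_balls_mult =
  bounded_bilinear.lipschitz_on_balls_bilinear[OF bounded_bilinear_mult]
lemmas lipschitz_on_balls_inner =
  bounded_bilinear.lipschitz_on_balls_bilinear[OF bounded_bilinear_inner]

section \<open>Existence and uniqueness for autonomous differential equations\<close>

text \<open>The Picard operator is a contraction for the norm
  \<open>sup\<^sub>t exp (- 2 * L * t) * norm (z t)\<close>, which yields the solution on the whole half-line at once,
  without gluing local solutions. Substituting \<open>w t = exp (- 2 * L * t) *\<^sub>R z t\<close> turns the weighted
  norm into the supremum norm of bounded continuous functions; the bound on \<open>G\<close> keeps the
  operator inside that space.\<close>

lemma bounded_lipschitz_global_solution: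
  fixes G :: "'a::banach \<Rightarrow> 'a"
  assumes L: "L > 0" "L-lipschitz_on UNIV G" and M: "\<And>p. norm (G p) \<le> M"
  obtains z where "solves_ivp G z0 z {0..}"
proof -
  have "M \<ge> 0" using M[of 0] norm_ge_zero[of "G 0"] by linarith
  have cont_G: "continuous_on UNIV G" using L(2) by (rule lipschitz_on_continuous_on)
  define h where "h w s = G (exp (2 * L * s) *\<^sub>R apply_bcontfun w s)" for w :: "real \<Rightarrow>\<^sub>C 'a" and s
  have cont_h: "continuous_on S (h w)" for S w
    unfolding h_def by (rule continuous_on_compose2[OF cont_G]) (auto intro!: continuous_intros)
  define I where "I w t = integral {0..t} (h w)" for w and t :: real
  have I_deriv: "((I w) has_vector_derivative h w t) (at t within {0..b})" if "t \<in> {0..b}" for w t b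
    unfolding I_def by (rule integral_has_vector_derivative[OF cont_h that])
  have cont_I: "continuous_on {0..} (I w)" for w
  proof (rule continuous_on_vector_derivative)
    fix t :: real assume "t \<in> {0..}"
    then have "(I w has_vector_derivative h w t) (at t within {0..t + 1})"
      by (intro I_deriv) auto
    moreover have "at t within {0..t + 1} = at t within {0..}"
      by (rule at_within_nhd[of _ "{..<t + 1}"]) auto
    ultimately show "(I w has_vector_derivative h w t) (at t within {0..})" by simp
  qed
  \<comment> \<open>Bounded continuous functions live on the whole line, so time is clamped at \<open>0\<close>.\<close>
  define \<Psi> where "\<Psi> w t = exp (- (2 * L * max 0 t)) *\<^sub>R (z0 + I w (max 0 t))" for w t
  have "\<Psi> w \<in> bcontfun" for w
  proof (rule bcontfun_normI)
    have "continuous_on UNIV (\<lambda>t. I w (max 0 t))"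
    proof (rule continuous_on_compose2[OF cont_I])
      show "continuous_on UNIV (\<lambda>t::real. max 0 t)" by (intro continuous_intros)
    qed (auto intro: max.cobounded1)
    then show "continuous_on UNIV (\<Psi> w)"
      unfolding \<Psi>_def by (intro continuous_intros)
    fix t :: real
    define s where "s = max 0 t"
    have s: "s \<ge> 0" by (simp add: s_def)
    have "norm (I w s) \<le> M * (s - 0)"
      unfolding I_def by (rule integral_bound[OF s cont_h]) (auto simp: h_def M)
    moreover have "norm (z0 + I w s) \<le> norm z0 + norm (I w s)" by (rule norm_triangle_ineq)
    ultimately have "norm (\<Psi> w t) \<le> exp (- (2 * L * s)) * (norm z0 + M * s)"
      unfolding \<Psi>_def s_def[symmetric] by simp
    also have "\<dots> = exp (- (2 * L * s)) * norm z0 + M * (exp (- (2 * L * s)) * s)"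
      by (simp add: algebra_simps)
    also have "\<dots> \<le> 1 * norm z0 + M * (1 / (2 * L))"
    proof (intro add_mono mult_right_mono mult_left_mono)
      have "2 * L * s \<le> exp (2 * L * s)" using exp_ge_add_one_self[of "2 * L * s"] by linarith
      then show "exp (- (2 * L * s)) * s \<le> 1 / (2 * L)"
        using L(1) by (simp add: exp_minus field_simps)
    qed (use L(1) s \<open>M \<ge> 0\<close> in auto)
    finally show "norm (\<Psi> w t) \<le> 1 * norm z0 + M * (1 / (2 * L))" .
  qed
  then have app: "apply_bcontfun (Bcontfun (\<Psi> w)) = \<Psi> w" for w
    by (simp add: Bcontfun_inverse)
  have contr: "dist (Bcontfun (\<Psi> w)) (Bcontfun (\<Psi> v)) \<le> (1/2) * dist w v" for w v
  proof (rule dist_bound)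
    fix t :: real
    define s where "s = max 0 t"
    have s: "s \<ge> 0" by (simp add: s_def)
    \<comment> \<open>The weight makes the integral of the Lipschitz bound gain the factor \<open>1 / (2 * L)\<close>, whence the
      contraction constant \<open>1 / 2\<close>.\<close>
    define d where "d = dist w v"
    have "((\<lambda>u. L * exp (2 * L * u) * d) has_integral
        (exp (2 * L * s) / 2 * d - exp (2 * L * 0) / 2 * d)) {0..s}"
      by (rule fundamental_theorem_of_calculus[OF s])
        (auto simp: has_real_derivative_iff_has_vector_derivative[symmetric] intro!: derivative_eq_intros)
    then have majorant: "integral {0..s} (\<lambda>u. L * exp (2 * L * u) * d) = exp (2 * L * s) / 2 * d - d / 2"
      by (subst integral_unique) auto
    have "norm (integral {0..s} (\<lambda>u. h w u - h v u)) \<le> integral {0..s} (\<lambda>u. L * exp (2 * L * u) * d)"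
    proof (rule integral_norm_bound_integral)
      fix u assume "u \<in> {0..s}"
      have "norm (h w u - h v u) \<le> L * norm (exp (2 * L * u) *\<^sub>R w u - exp (2 * L * u) *\<^sub>R v u)"
        unfolding h_def by (rule lipschitz_on_normD[OF L(2)]) auto
      also have "\<dots> = L * exp (2 * L * u) * dist (w u) (v u)"
        by (simp add: dist_norm scaleR_diff_right[symmetric])
      also have "\<dots> \<le> L * exp (2 * L * u) * d"
        unfolding d_def using L(1) by (intro mult_left_mono dist_bounded) auto
      finally show "norm (h w u - h v u) \<le> L * exp (2 * L * u) * d" .
    qed (auto intro!: integrable_continuous_real continuous_intros cont_h)
    then have "norm (I w s - I v s) \<le> exp (2 * L * s) / 2 * d - d / 2"
      unfolding I_def majorant
      by (subst integral_diff[symmetric]) (auto intro!: integrable_continuous_real cont_h)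
    also have "\<dots> \<le> exp (2 * L * s) / 2 * d" by (simp add: d_def)
    finally have "exp (- (2 * L * s)) * norm (I w s - I v s) \<le> exp (- (2 * L * s)) * (exp (2 * L * s) / 2 * d)"
      by (intro mult_left_mono) auto
    also have "\<dots> = 1/2 * d" by (simp add: exp_minus)
    also have "exp (- (2 * L * s)) * norm (I w s - I v s) = dist (\<Psi> w t) (\<Psi> v t)"
      unfolding \<Psi>_def s_def[symmetric] by (simp add: dist_norm scaleR_diff_right[symmetric])
    finally show "dist (apply_bcontfun (Bcontfun (\<Psi> w)) t) (apply_bcontfun (Bcontfun (\<Psi> v)) t) \<le> 1/2 * dist w v"
      by (simp add: app d_def)
  qed
  obtain w where "Bcontfun (\<Psi> w) = w"
    using banach_fix_type[of "1/2" "\<lambda>w. Bcontfun (\<Psi> w)"] contr by auto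
  then have w: "apply_bcontfun w = \<Psi> w" using app by metis
  define z where "z t = z0 + I w t" for t
  have hz: "h w t = G (z t)" if "t \<ge> 0" for t
  proof -
    have "w t = exp (- (2 * L * t)) *\<^sub>R z t" using that by (simp add: w \<Psi>_def z_def)
    then show ?thesis unfolding h_def by (simp add: exp_minus)
  qed
  have "solves_ivp G z0 z {0..}"
    unfolding solves_ivp_def
  proof (intro conjI ballI)
    show "z 0 = z0" by (simp add: z_def I_def)
    fix t :: real assume t: "t \<in> {0..}"
    then have "(I w has_vector_derivative h w t) (at t within {0..t + 1})"
      by (intro I_deriv) auto
    moreover have "at t within {0..t + 1} = at t within {0..}"
      by (rule at_within_nhd[of _ "{..<t + 1}"]) auto
    ultimately have "(I w has_vector_derivative h w t) (at t within {0..})" by simp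
    then show "(z has_vector_derivative G (z t)) (at t within {0..})"
      using hz[of t] t unfolding z_def by (auto intro!: derivative_eq_intros)
  qed
  then show ?thesis by (rule that)
qed

lemma solves_ivp_subset:
  assumes "solves_ivp F z0 z T" "S \<subseteq> T"
  shows "solves_ivp F z0 z S"
  using assms unfolding solves_ivp_def by (meson has_vector_derivative_within_subset subsetD)

lemma solves_ivp_continuous_on:
  assumes "solves_ivp F z0 z T"
  shows "continuous_on T z"
  using assms unfolding solves_ivp_def by (meson continuous_on_vector_derivative)

lemma increment_le_of_derivative_le:
  fixes \<phi> :: "real \<Rightarrow> real"
  assumes "a \<le> b"
    and "\<And>t. t \<in> {a..b} \<Longrightarrow> (\<phi> has_real_derivative \<phi>' t) (at t within {a..b})"
    and "\<And>t. t \<in> {a..b} \<Longrightarrow> \<phi>' t \<le> K"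
  shows "\<phi> b - \<phi> a \<le> K * (b - a)"
proof -
  obtain t where "t \<in> {a..b}" "\<phi> b - \<phi> a = \<phi>' t * (b - a)"
    using mvt_very_simple[OF assms(1), of \<phi> "\<lambda>t. (*) (\<phi>' t)"] assms(2)
    by (auto simp: has_field_derivative_def)
  then show ?thesis using assms(1,3) by (simp add: mult_right_mono)
qed

text \<open>Gronwall's argument: the two solutions stay in a common ball up to time \<open>T\<close>, on which \<open>F\<close> has
  a Lipschitz constant \<open>L\<close>, so that \<open>exp (- 2 * L * t)\<close> times their squared distance cannot
  increase from \<open>0\<close>.\<close>

lemma solution_unique:
  fixes F :: "'a::euclidean_space \<Rightarrow> 'a"
  assumes F: "lipschitz_on_balls F"
    and z: "solves_ivp F z0 z {0..T}" and w: "solves_ivp F z0 w {0..T}" and "T \<ge> 0"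
  shows "z T = w T"
proof -
  have "bounded (z ` {0..T} \<union> w ` {0..T})"
    using solves_ivp_continuous_on[OF z] solves_ivp_continuous_on[OF w]
    by (auto intro!: compact_imp_bounded compact_continuous_image)
  then obtain R where R: "\<And>p. p \<in> z ` {0..T} \<union> w ` {0..T} \<Longrightarrow> norm p \<le> R"
    unfolding bounded_iff by blast
  obtain L where L: "L > 0" "L-lipschitz_on (cball 0 R) F"
    using F by (rule lipschitz_on_ballsE)
  define \<phi> where "\<phi> t = exp (- (2 * L * t)) * ((z t - w t) \<bullet> (z t - w t))" for t
  define \<phi>' where "\<phi>' t = exp (- (2 * L * t)) *
     (2 * ((z t - w t) \<bullet> (F (z t) - F (w t))) - 2 * L * ((z t - w t) \<bullet> (z t - w t)))" for t
  have "\<phi> T - \<phi> 0 \<le> 0 * (T - 0)"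
  proof (rule increment_le_of_derivative_le[OF \<open>T \<ge> 0\<close>])
    fix t assume t: "t \<in> {0..T}"
    have "(z has_vector_derivative F (z t)) (at t within {0..T})"
      "(w has_vector_derivative F (w t)) (at t within {0..T})"
      using z w t by (auto simp: solves_ivp_def)
    then show "(\<phi> has_real_derivative \<phi>' t) (at t within {0..T})"
      unfolding \<phi>_def \<phi>'_def has_field_derivative_def has_vector_derivative_def
      by (auto intro!: derivative_eq_intros simp: inner_commute algebra_simps fun_eq_iff)
    have "(z t - w t) \<bullet> (F (z t) - F (w t)) \<le> norm (z t - w t) * norm (F (z t) - F (w t))"
      by (rule norm_cauchy_schwarz)
    also have "\<dots> \<le> norm (z t - w t) * (L * norm (z t - w t))"
      using R t by (intro mult_left_mono lipschitz_on_normD[OF L(2)]) auto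
    also have "\<dots> = L * ((z t - w t) \<bullet> (z t - w t))"
      by (simp add: power2_norm_eq_inner[symmetric] power2_eq_square)
    finally show "\<phi>' t \<le> 0"
      unfolding \<phi>'_def by (intro mult_nonneg_nonpos) auto
  qed
  moreover have "\<phi> 0 = 0" using z w by (simp add: \<phi>_def solves_ivp_def)
  ultimately have "exp (- (2 * L * T)) * (norm (z T - w T))\<^sup>2 \<le> 0"
    by (simp add: \<phi>_def power2_norm_eq_inner)
  then show ?thesis by (simp add: mult_le_0_iff)
qed

text \<open>Solutions can only fail to be global by blowing up. The field is cut off by projecting the state
  to a ball that is slightly larger than the a priori bound; the modified field is bounded and
  globally Lipschitz. Until its solution first reaches the boundary of the larger ball it solves
  the original equation, so the bound prevents it from ever getting there.\<close>

lemma global_solution_of_a_priori_bound: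
  fixes F :: "'a::euclidean_space \<Rightarrow> 'a"
  assumes F: "lipschitz_on_balls F"
    and bound: "\<And>T w. T \<ge> 0 \<Longrightarrow> solves_ivp F z0 w {0..T} \<Longrightarrow> norm (w T) \<le> R"
  obtains z where "is_global_solution F z0 z"
proof -
  define B where "B = cball (0::'a) (R + 1)"
  \<comment> \<open>Every curve through \<open>z0\<close> is a solution on the degenerate interval \<open>{0..0}\<close>.\<close>
  have "norm z0 \<le> R"
    using bound[of 0 "\<lambda>_. z0"] by (simp add: solves_ivp_def has_vector_derivative_def has_derivative_within_singleton_iff bounded_linear_scaleR_left)
  then have "R \<ge> 0" using norm_ge_zero[of z0] by linarith
  then have B: "closed B" "convex B" "B \<noteq> {}" by (auto simp: B_def)
  define G where "G p = F (closest_point B p)" for p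
  have inB: "norm (closest_point B p) \<le> R + 1" for p
    using closest_point_in_set[OF B(1,3), of p] by (simp add: B_def)
  have G_eq: "G p = F p" if "norm p \<le> R + 1" for p
    using that by (simp add: G_def closest_point_self B_def)
  obtain L where L: "L > 0" "L-lipschitz_on (cball 0 (R + 1)) F"
    using F by (rule lipschitz_on_ballsE)
  obtain M where M: "\<And>p. norm p \<le> R + 1 \<Longrightarrow> norm (F p) \<le> M"
    using lipschitz_on_balls_bounded[OF F] by metis
  have "L-lipschitz_on UNIV G"
  proof (rule lipschitz_onI)
    fix p q
    have "dist (G p) (G q) \<le> L * dist (closest_point B p) (closest_point B q)"
      unfolding G_def using inB by (intro lipschitz_onD[OF L(2)]) auto
    also have "\<dots> \<le> L * dist p q"
      using L(1) closest_point_lipschitz[OF B(2,1,3)] by (intro mult_left_mono) auto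
    finally show "dist (G p) (G q) \<le> L * dist p q" .
  qed (use L in auto)
  then obtain z where z: "solves_ivp G z0 z {0..}"
    using bounded_lipschitz_global_solution[OF L(1), of G M] M inB unfolding G_def by metis
  have cont: "continuous_on {0..} z" using z by (rule solves_ivp_continuous_on)
  have solves: "solves_ivp F z0 z S" if "S \<subseteq> {0..}" "\<And>t. t \<in> S \<Longrightarrow> norm (z t) \<le> R + 1" for S
    using solves_ivp_subset[OF z that(1)] that G_eq unfolding solves_ivp_def by metis
  have crossing: "\<exists>s\<in>{0..t}. norm (z s) = R + 1" if "t \<ge> 0" "R + 1 \<le> norm (z t)" for t
  proof -
    have "continuous_on {0..t} (\<lambda>s. norm (z s))"
      by (intro continuous_on_norm continuous_on_subset[OF cont]) auto
    then show ?thesis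
      using IVT'[of "\<lambda>s. norm (z s)" 0 "R + 1" t] that z \<open>norm z0 \<le> R\<close>
      by (auto simp: solves_ivp_def)
  qed
  have small: "norm (z t) < R + 1" if t: "t \<ge> 0" for t
  proof (rule ccontr)
    assume large: "\<not> norm (z t) < R + 1"
    define S where "S = {t \<in> {0..}. norm (z t) = R + 1}"
    obtain s where s: "s \<in> S" using crossing[OF t] large unfolding S_def by auto
    have "closed S"
      unfolding S_def
      by (intro continuous_closed_preimage_constant continuous_on_norm cont closed_atLeast)
    have bdd: "bdd_below S" by (rule bdd_belowI[of _ 0]) (simp add: S_def)
    \<comment> \<open>\<open>T\<close> is the first time at which the solution reaches the sphere.\<close>
    define T where "T = Inf S"
    have T: "T \<in> S" unfolding T_def using s \<open>closed S\<close> bdd by (intro closed_contains_Inf) auto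
    have "norm (z s) \<le> R + 1" if s: "s \<in> {0..T}" for s
    proof (rule ccontr)
      assume "\<not> norm (z s) \<le> R + 1"
      then obtain r where r: "r \<in> {0..s}" "norm (z r) = R + 1"
        using crossing[of s] s by auto
      then have "T \<le> r" unfolding T_def by (intro cInf_lower bdd) (simp add: S_def)
      then have "r = s" using r s by simp
      then show False using r \<open>\<not> norm (z s) \<le> R + 1\<close> by simp
    qed
    then have "solves_ivp F z0 z {0..T}" by (intro solves) auto
    then show False using bound[of T z] T by (auto simp: S_def)
  qed
  have sol: "solves_ivp F z0 z {0..}" using small by (intro solves) (auto intro: less_imp_le)
  have "is_global_solution F z0 z"
    unfolding is_global_solution_def
  proof (intro conjI sol allI impI ballI)
    fix T w t assume w: "solves_ivp F z0 w {0..<T}" and t: "t \<in> {0..<T}"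
    show "w t = z t"
      by (rule solution_unique[OF F solves_ivp_subset[OF w] solves_ivp_subset[OF sol]]) (use t in auto)
  qed
  then show ?thesis by (rule that)
qed

section \<open>Monotone and dissipated quantities\<close>

lemma has_vector_derivative_zero_imp_constant_on:
  assumes "convex S" "a \<in> S" "b \<in> S"
    and "\<And>t. t \<in> S \<Longrightarrow> (h has_vector_derivative 0) (at t within S)"
  shows "h a = h b"
  using has_vector_derivative_zero_constant[OF assms(1), of h] assms(2-4) by metis

lemma has_real_derivative_inner_self:
  assumes "(v has_vector_derivative V) (at t within S)"
  shows "((\<lambda>t. v t \<bullet> v t) has_real_derivative 2 * (v t \<bullet> V)) (at t within S)"
  using assms unfolding has_field_derivative_def has_vector_derivative_def
  by (auto intro!: derivative_eq_intros simp: inner_commute algebra_simps fun_eq_iff)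

lemma mono_bounded_converges_at_top:
  fixes g :: "real \<Rightarrow> real"
  assumes mono: "\<And>s t. 0 \<le> s \<Longrightarrow> s \<le> t \<Longrightarrow> g s \<le> g t" and bdd: "\<And>t. 0 \<le> t \<Longrightarrow> g t \<le> B"
  obtains l where "(g \<longlongrightarrow> l) at_top"
proof -
  have above: "bdd_above (g ` {0..})" using bdd by (auto intro!: bdd_aboveI[of _ B])
  have "(g \<longlongrightarrow> Sup (g ` {0..})) at_top"
  proof (rule order_tendstoI)
    fix a assume "a < Sup (g ` {0..})"
    then obtain s where s: "s \<ge> 0" "a < g s"
      using less_cSup_iff[OF _ above] by auto
    then show "eventually (\<lambda>t. a < g t) at_top"
      using mono[of s] by (intro eventually_at_top_linorderI[of s]) (auto intro: less_le_trans)
  next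
    fix a assume a: "Sup (g ` {0..}) < a"
    then show "eventually (\<lambda>t. g t < a) at_top"
      using cSup_upper[OF _ above]
      by (intro eventually_at_top_linorderI[of 0]) (auto intro: le_less_trans)
  qed
  then show ?thesis by (rule that)
qed

text \<open>A form of Barbalat's lemma. If \<open>u\<close> is at least \<open>\<epsilon>\<close> at time \<open>t\<close>, then by the bound on its slope
  it stays above \<open>\<epsilon> / 2\<close> for the fixed duration \<open>\<delta> = \<epsilon> / (2 * M)\<close>, during which \<open>V\<close> loses at
  least \<open>k * \<delta> * \<epsilon> / 2\<close>. As \<open>V\<close> decreases to a limit, this cannot happen at late times.\<close>

lemma tendsto_zero_of_dissipation:
  fixes V u :: "real \<Rightarrow> real"
  assumes V: "\<And>t. t \<ge> 0 \<Longrightarrow> (V has_real_derivative V' t) (at t within {0..})"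
    and V_nonneg: "\<And>t. t \<ge> 0 \<Longrightarrow> V t \<ge> 0"
    and u: "\<And>t. t \<ge> 0 \<Longrightarrow> (u has_real_derivative u' t) (at t within {0..})"
    and u_nonneg: "\<And>t. t \<ge> 0 \<Longrightarrow> u t \<ge> 0"
    and "k > 0" and dissipation: "\<And>t. t \<ge> 0 \<Longrightarrow> V' t \<le> - k * u t"
    and "M > 0" and slope: "\<And>t. t \<ge> 0 \<Longrightarrow> - M \<le> u' t"
  shows "(u \<longlongrightarrow> 0) at_top"
proof -
  have sub: "(g has_real_derivative d) (at t within {a..b})"
    if "(g has_real_derivative d) (at t within {0..})" "0 \<le> a" for g d t a b
    by (rule has_field_derivative_subset[OF that(1)]) (use that(2) in auto)
  have V_drop: "V t - V s \<le> - (k * r) * (t - s)"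
    if "0 \<le> s" "s \<le> t" "\<And>v. v \<in> {s..t} \<Longrightarrow> r \<le> u v" for s t r
  proof (rule increment_le_of_derivative_le[OF that(2)])
    fix v assume v: "v \<in> {s..t}"
    show "(V has_real_derivative V' v) (at v within {s..t})" using v that by (intro sub V) auto
    have "k * r \<le> k * u v" using \<open>k > 0\<close> that(3)[OF v] by simp
    then show "V' v \<le> - (k * r)" using dissipation[of v] v that(1) by auto
  qed
  have "V t \<le> V s" if "0 \<le> s" "s \<le> t" for s t
    using V_drop[OF that, of 0] u_nonneg that by auto
  then obtain l where "((\<lambda>t. - V t) \<longlongrightarrow> l) at_top"
    using mono_bounded_converges_at_top[of "\<lambda>t. - V t" 0] V_nonneg by auto
  then have lim: "(V \<longlongrightarrow> - l) at_top" using tendsto_minus[of "\<lambda>t. - V t"] by simp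
  show ?thesis
  proof (rule tendstoI)
    fix \<epsilon> :: real assume "\<epsilon> > 0"
    define \<delta> where "\<delta> = \<epsilon> / (2 * M)"
    have \<delta>: "\<delta> > 0" using \<open>\<epsilon> > 0\<close> \<open>M > 0\<close> by (simp add: \<delta>_def)
    have "((\<lambda>t. V (t + \<delta>)) \<longlongrightarrow> - l) at_top"
      by (rule filterlim_compose[OF lim]) (use \<delta> in \<open>auto intro!: filterlim_at_top_mono[OF filterlim_ident]\<close>)
    then have "((\<lambda>t. V t - V (t + \<delta>)) \<longlongrightarrow> 0) at_top"
      using tendsto_diff[OF lim] by force
    moreover have "k * \<delta> * (\<epsilon> / 2) > 0" using \<open>k > 0\<close> \<delta> \<open>\<epsilon> > 0\<close> by simp
    ultimately have "eventually (\<lambda>t. V t - V (t + \<delta>) < k * \<delta> * (\<epsilon> / 2)) at_top"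
      by (rule order_tendstoD)
    then show "eventually (\<lambda>t. dist (u t) 0 < \<epsilon>) at_top"
      using eventually_ge_at_top[of 0]
    proof eventually_elim
      case (elim t)
      have "u t - \<epsilon> / 2 \<le> u v" if v: "v \<in> {t..t + \<delta>}" for v
      proof -
        have "(- u v) - (- u t) \<le> M * (v - t)"
        proof (rule increment_le_of_derivative_le)
          fix r assume "r \<in> {t..v}"
          then show "((\<lambda>r. - u r) has_real_derivative - u' r) (at r within {t..v})" "- u' r \<le> M"
            using elim(2) slope[of r] by (auto intro!: derivative_intros sub u)
        qed (use v in auto)
        also have "\<dots> \<le> M * \<delta>" using v \<open>M > 0\<close> by (intro mult_left_mono) auto
        also have "\<dots> = \<epsilon> / 2" using \<open>M > 0\<close> by (simp add: \<delta>_def)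
        finally show ?thesis by simp
      qed
      then have "V (t + \<delta>) - V t \<le> - (k * (u t - \<epsilon> / 2)) * (t + \<delta> - t)"
        using elim(2) \<delta> by (intro V_drop) auto
      then have "(k * \<delta>) * (u t - \<epsilon> / 2) < (k * \<delta>) * (\<epsilon> / 2)"
        using elim(1) by (simp add: algebra_simps)
      then have "u t - \<epsilon> / 2 < \<epsilon> / 2"
        using \<open>k > 0\<close> \<delta> by (simp only: mult_less_cancel_left_pos mult_pos_pos)
      then show ?case using u_nonneg[OF elim(2)] by simp
    qed
  qed
qed


section \<open>The vector field and its coupling graph\<close>

text \<open>Fermat's rule on the line of unilateral deviations of player \<open>i\<close>. Differentiability is what makes
  \<open>deriv\<close> meaningful there.\<close>

lemma nash_equilibrium_partial_derivative_eq_0: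
  assumes "twice_continuously_differentiable (f i)" "nash_equilibrium f xs"
  shows "partial_derivative i (f i) xs = 0"
proof -
  obtain f' where f': "\<And>x. (f i has_derivative blinfun_apply (f' x)) (at x)"
    using assms(1) unfolding twice_continuously_differentiable_def by blast
  have dev: "deviate xs i s = xs + (s - xs $ i) *\<^sub>R axis i 1" for s
    by (simp add: deviate_def vec_eq_iff axis_def)
  have "deviate xs i (xs $ i) = xs" by (simp add: dev)
  have "((\<lambda>s. deviate xs i s) has_derivative (\<lambda>h. h *\<^sub>R axis i 1)) (at (xs $ i))"
    unfolding dev by (auto intro!: derivative_eq_intros)
  then have "((\<lambda>s. f i (deviate xs i s)) has_derivative (\<lambda>h. f' xs (h *\<^sub>R axis i 1))) (at (xs $ i))"
    by (rule has_derivative_compose) (simp add: \<open>deviate xs i (xs $ i) = xs\<close> f')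
  then have D: "((\<lambda>s. f i (deviate xs i s)) has_real_derivative f' xs (axis i 1)) (at (xs $ i))"
    by (simp add: has_field_derivative_def blinfun.scaleR_right mult_commute_abs)
  have "f' xs (axis i 1) = 0"
    using assms(2) \<open>deviate xs i (xs $ i) = xs\<close>
    by (intro DERIV_local_min[OF D zero_less_one]) (auto simp: nash_equilibrium_def)
  then show ?thesis using D by (simp add: partial_derivative_def DERIV_imp_deriv)
qed

text \<open>The gains enter the field multiplied by states and the gain rates are quadratic, so in
  general the field is not globally Lipschitz: existence for all times needs the Lyapunov bound further below.\<close>

lemma lipschitz_on_balls_seeking_dynamics:
  fixes f :: "'n::finite \<Rightarrow> real ^ 'n \<Rightarrow> real"
  assumes "\<And>i. (L i)-lipschitz_on UNIV (partial_derivative i (f i))"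
  shows "lipschitz_on_balls (seeking_dynamics f E)"
proof -
  have lin: "lipschitz_on_balls (\<lambda>p::'n state. fst p $ i)"
    "lipschitz_on_balls (\<lambda>p::'n state. fst (snd p) $ i)"
    "lipschitz_on_balls (\<lambda>p::'n state. fst (snd p) $ i $ j)"
    "lipschitz_on_balls (\<lambda>p::'n state. fst (snd (snd p)) $ i $ j)"
    "lipschitz_on_balls (\<lambda>p::'n state. snd (snd (snd p)) $ i $ j)" for i j
    by (auto intro!: lipschitz_on_balls_bounded_linear linearI
        simp: linear_conv_bounded_linear[symmetric])
  show ?thesis
    unfolding seeking_dynamics_def case_prod_beta power2_eq_square
    by (intro lipschitz_on_balls_Pair lipschitz_on_balls_vec_lambda lipschitz_on_balls_minus
        lipschitz_on_balls_add lipschitz_on_balls_diff lipschitz_on_balls_sum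
        lipschitz_on_balls_mult lipschitz_on_balls_inner lipschitz_on_balls_const
        lipschitz_on_balls_lipschitz_compose[OF _ assms] lin)
qed

text \<open>The quadratic form that the coupling terms dissipate: the Laplacian form of the graph, plus a
  pinning term that compares the estimate of player \<open>j\<close>'s action with the true action, but only at
  the neighbours of \<open>j\<close>.\<close>

definition disagreement :: "('n \<times> 'n) set \<Rightarrow> real ^ 'n ^ 'n::finite \<Rightarrow> real" where
  "disagreement E e =
     (\<Sum>i\<in>UNIV. \<Sum>k\<in>UNIV. adjacency E i k * ((e $ i - e $ k) \<bullet> (e $ i - e $ k))) / 2
     + (\<Sum>i\<in>UNIV. \<Sum>j\<in>UNIV. adjacency E i j * (e $ i $ j)\<^sup>2)"

lemma adjacency_nonneg: "adjacency E i j \<ge> 0"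
  by (simp add: adjacency_def)

lemma disagreement_nonneg: "disagreement E e \<ge> 0"
  unfolding disagreement_def
  by (intro add_nonneg_nonneg divide_nonneg_nonneg sum_nonneg mult_nonneg_nonneg adjacency_nonneg) auto

lemma disagreement_scaleR: "disagreement E (r *\<^sub>R e) = r\<^sup>2 * disagreement E e"
  unfolding disagreement_def
  by (simp add: scaleR_diff_right[symmetric] power2_eq_square sum_distrib_left distrib_left mult_ac)

lemma sum_sum_nonneg_eq_0D:
  fixes g :: "'i::finite \<Rightarrow> 'k::finite \<Rightarrow> real"
  assumes "(\<Sum>i\<in>UNIV. \<Sum>k\<in>UNIV. g i k) = 0" "\<And>i k. g i k \<ge> 0"
  shows "g i k = 0"
  using assms by (simp add: sum_nonneg_eq_0_iff sum_nonneg)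

text \<open>The Laplacian part forces all players to have the same error vector, by connectedness. Every
  player \<open>j\<close> has a neighbour, and there the pinning term annihilates component \<open>j\<close> of this
  common vector.\<close>

lemma disagreement_eq_0D:
  fixes e :: "real ^ 'n ^ 'n::finite"
  assumes "CARD('n) \<ge> 2" "\<And>i j. (i, j) \<in> E\<^sup>*" "disagreement E e = 0"
  shows "e = 0"
proof -
  let ?g = "\<lambda>i k. adjacency E i k * ((e $ i - e $ k) \<bullet> (e $ i - e $ k))"
  let ?h = "\<lambda>i k. adjacency E i k * (e $ i $ k)\<^sup>2"
  have g: "?g i k \<ge> 0" and h: "?h i k \<ge> 0" for i k
    by (simp_all add: adjacency_nonneg)
  then have "(\<Sum>i\<in>UNIV. \<Sum>k\<in>UNIV. ?g i k) \<ge> 0" "(\<Sum>i\<in>UNIV. \<Sum>k\<in>UNIV. ?h i k) \<ge> 0"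
    by (intro sum_nonneg; simp)+
  then have "(\<Sum>i\<in>UNIV. \<Sum>k\<in>UNIV. ?g i k) = 0" "(\<Sum>i\<in>UNIV. \<Sum>k\<in>UNIV. ?h i k) = 0"
    using assms(3) unfolding disagreement_def by linarith+
  then have "?g i k = 0" "?h i k = 0" for i k
    using sum_sum_nonneg_eq_0D[of ?g i k] sum_sum_nonneg_eq_0D[of ?h i k] g h by blast+
  then have edge: "e $ i = e $ k" "e $ i $ k = 0" if "(k, i) \<in> E" for i k
    using \<open>?g i k = 0\<close> \<open>?h i k = 0\<close> that by (simp_all add: adjacency_def)
  have same: "e $ i = e $ k" for i k
    using assms(2)[of i k]
  proof (induction rule: rtrancl_induct)
    case (step u v)
    then show ?case using edge(1)[of u v] by simp
  qed simp
  have "e $ k $ j = 0" for k j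
  proof -
    obtain i where "i \<noteq> j"
    proof (rule ccontr)
      assume "\<not> thesis"
      then have "UNIV = {j}" using that by auto
      then have "CARD('n) = card {j}" by (rule arg_cong)
      then show False using assms(1) by simp
    qed
    then obtain i where "(j, i) \<in> E"
      using assms(2)[of j i] by (auto elim: converse_rtranclE)
    then show ?thesis using edge(2)[of j i] same[of k i] by simp
  qed
  then show ?thesis by (simp add: vec_eq_iff)
qed

text \<open>A nonnegative quadratic form that vanishes only at \<open>0\<close> is bounded below by a multiple of the
  squared norm: the constant is its minimum on the unit sphere.\<close>

lemma disagreement_coercive:
  fixes E :: "('n::finite \<times> 'n) set"
  assumes "CARD('n) \<ge> 2" "\<And>i j. (i, j) \<in> E\<^sup>*"
  obtains \<kappa> where "\<kappa> > 0" "\<And>e :: real ^ 'n ^ 'n. \<kappa> * (norm e)\<^sup>2 \<le> disagreement E e"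
proof -
  let ?S = "sphere (0 :: real ^ 'n ^ 'n) 1"
  have "continuous_on ?S (disagreement E)"
    unfolding disagreement_def by (intro continuous_intros) auto
  moreover have "?S \<noteq> {}" by simp
  ultimately obtain u where u: "u \<in> ?S" "\<And>v. v \<in> ?S \<Longrightarrow> disagreement E u \<le> disagreement E v"
    using continuous_attains_inf[of ?S "disagreement E"] by auto
  have "disagreement E u > 0"
    using disagreement_eq_0D[OF assms, of u] disagreement_nonneg[of E u] u(1) by force
  moreover have "disagreement E u * (norm e)\<^sup>2 \<le> disagreement E e" for e :: "real ^ 'n ^ 'n"
  proof (cases "e = 0")
    case False
    then have "disagreement E u * (norm e)\<^sup>2 \<le> disagreement E (e /\<^sub>R norm e) * (norm e)\<^sup>2"
      by (intro mult_right_mono u(2)) auto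
    also have "\<dots> = disagreement E e"
      using False by (simp add: disagreement_scaleR power_inverse)
    finally show ?thesis .
  qed (simp add: disagreement_nonneg)
  ultimately show ?thesis by (rule that)
qed

lemma sum_symmetric_weights_inner:
  fixes v :: "'i::finite \<Rightarrow> 'a::real_inner"
  assumes "\<And>i k. w i k = w k i"
  shows "(\<Sum>i\<in>UNIV. \<Sum>k\<in>UNIV. w i k * (v i \<bullet> (v i - v k))) =
    (\<Sum>i\<in>UNIV. \<Sum>k\<in>UNIV. w i k * ((v i - v k) \<bullet> (v i - v k))) / 2" (is "?S = _")
proof -
  have "?S = (\<Sum>i\<in>UNIV. \<Sum>k\<in>UNIV. w i k * (v k \<bullet> (v k - v i)))"
    by (subst sum.swap) (intro sum.cong refl arg_cong2[where f = "(*)"] assms)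
  then have "?S + ?S = (\<Sum>i\<in>UNIV. \<Sum>k\<in>UNIV. w i k * (v i \<bullet> (v i - v k)) + w i k * (v k \<bullet> (v k - v i)))"
    by (simp add: sum.distrib)
  also have "\<dots> = (\<Sum>i\<in>UNIV. \<Sum>k\<in>UNIV. w i k * ((v i - v k) \<bullet> (v i - v k)))"
    by (intro sum.cong refl) (simp add: inner_diff_left inner_diff_right inner_commute algebra_simps)
  finally show ?thesis by simp
qed

lemma norm_replicate_profile_le: "norm (replicate_profile v) \<le> CARD('n) * norm (v :: real ^ 'n::finite)"
proof -
  have "norm (replicate_profile v) \<le> (\<Sum>i\<in>UNIV. norm (replicate_profile v $ i))"
    by (subst norm_vec_def) (rule L2_set_le_sum, simp)
  then show ?thesis by (simp add: replicate_profile_def)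
qed

lemma replicate_profile_diff: "replicate_profile (v - w) = replicate_profile v - replicate_profile w"
  by (simp add: replicate_profile_def vec_eq_iff)

lemma adjacency_sym: "sym E \<Longrightarrow> adjacency E i j = adjacency E j i"
  by (auto simp: adjacency_def dest: symD)

text \<open>The reason for the adaptive laws. The contribution of the gains \<open>c\<close> and \<open>cb\<close> to the power of the
  error \<open>e\<close> is cancelled by the derivative of the gain part of the Lyapunov function, and what is
  left acts as if all gains were equal to \<open>cs\<close>. Symmetry of \<open>c\<close> enters through the Laplacian
  identity; it also explains the weight \<open>1 / 2\<close> here (\<open>1 / 4\<close> in the Lyapunov function), since each
  undirected edge carries the gain twice.\<close>

lemma coupling_power:
  fixes x :: "real ^ 'n::finite"
  assumes "seeking_dynamics f E (x, y, c, cb) = (X, Y, C, D)"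
    and "sym E" and c: "\<And>i j. c $ i $ j = c $ j $ i"
    and e: "e = y - replicate_profile x"
  shows "e \<bullet> Y + (c - (\<chi> i j. cs)) \<bullet> C / 2 + (cb - (\<chi> i j. cs)) \<bullet> D = - cs * disagreement E e"
proof -
  let ?a = "adjacency E"
  define d where "d i k = (e $ i - e $ k) \<bullet> (e $ i - e $ k)" for i k
  have "y $ i = e $ i + x" "y $ i $ j = e $ i $ j + x $ j" for i j
    by (simp_all add: e replicate_profile_def)
  then have Y: "Y $ i $ j = - ((\<Sum>k\<in>UNIV. ?a i k * c $ i $ k * (e $ i $ j - e $ k $ j)) + ?a i j * cb $ i $ j * e $ i $ j)"
    and C: "C $ i $ j = ?a i j * d i j"
    and D: "D $ i $ j = ?a i j * (e $ i $ j)\<^sup>2" for i j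
    using assms(1) by (auto simp: seeking_dynamics_def d_def)
  have "e \<bullet> Y = (\<Sum>i\<in>UNIV. - (\<Sum>j\<in>UNIV. \<Sum>k\<in>UNIV. ?a i k * c $ i $ k * (e $ i $ j * (e $ i $ j - e $ k $ j)))
      - (\<Sum>j\<in>UNIV. ?a i j * cb $ i $ j * (e $ i $ j)\<^sup>2))"
    unfolding inner_vec_def[of e] inner_vec_def[of "e $ _"] Y
    by (intro sum.cong refl)
      (simp add: algebra_simps sum_distrib_left sum.distrib sum_negf sum_subtractf power2_eq_square)
  also have "\<dots> = - (\<Sum>i\<in>UNIV. \<Sum>k\<in>UNIV. (?a i k * c $ i $ k) * (e $ i \<bullet> (e $ i - e $ k)))
      - (\<Sum>i\<in>UNIV. \<Sum>j\<in>UNIV. ?a i j * cb $ i $ j * (e $ i $ j)\<^sup>2)"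
    by (subst sum.swap[where A = UNIV and B = UNIV])
      (simp add: sum_subtractf sum_negf inner_vec_def[of "e $ _"] sum_distrib_left)
  also have "(\<Sum>i\<in>UNIV. \<Sum>k\<in>UNIV. (?a i k * c $ i $ k) * (e $ i \<bullet> (e $ i - e $ k)))
      = (\<Sum>i\<in>UNIV. \<Sum>k\<in>UNIV. (?a i k * c $ i $ k) * d i k) / 2"
    unfolding d_def by (rule sum_symmetric_weights_inner) (metis adjacency_sym[OF \<open>sym E\<close>] c)
  finally have 1: "e \<bullet> Y = - (\<Sum>i\<in>UNIV. \<Sum>k\<in>UNIV. (?a i k * c $ i $ k) * d i k) / 2
      - (\<Sum>i\<in>UNIV. \<Sum>j\<in>UNIV. ?a i j * cb $ i $ j * (e $ i $ j)\<^sup>2)" by simp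
  have 2: "(c - (\<chi> i j. cs)) \<bullet> C = (\<Sum>i\<in>UNIV. \<Sum>k\<in>UNIV. (?a i k * c $ i $ k) * d i k)
      - cs * (\<Sum>i\<in>UNIV. \<Sum>k\<in>UNIV. ?a i k * d i k)"
    unfolding inner_vec_def[of "c - _"] inner_vec_def[of "(c - _) $ _"] C
    by (simp add: algebra_simps sum_distrib_left sum_subtractf)
  have 3: "(cb - (\<chi> i j. cs)) \<bullet> D = (\<Sum>i\<in>UNIV. \<Sum>j\<in>UNIV. ?a i j * cb $ i $ j * (e $ i $ j)\<^sup>2)
      - cs * (\<Sum>i\<in>UNIV. \<Sum>j\<in>UNIV. ?a i j * (e $ i $ j)\<^sup>2)"
    unfolding inner_vec_def[of "cb - _"] inner_vec_def[of "(cb - _) $ _"] D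
    by (simp add: algebra_simps sum_distrib_left sum_subtractf)
  show ?thesis unfolding 1 2 3 disagreement_def d_def[symmetric] by (simp add: field_simps)
qed

section \<open>The Lyapunov function\<close>

definition lyapunov :: "real ^ 'n \<Rightarrow> real \<Rightarrow> 'n::finite state \<Rightarrow> real" where
  "lyapunov xs cs = (\<lambda>(x, y, c, cb).
     (x - xs) \<bullet> (x - xs) / 2
     + (y - replicate_profile x) \<bullet> (y - replicate_profile x) / 2
     + (c - (\<chi> i j. cs)) \<bullet> (c - (\<chi> i j. cs)) / 4
     + (cb - (\<chi> i j. cs)) \<bullet> (cb - (\<chi> i j. cs)) / 2)"

definition tracking_error :: "real ^ 'n \<Rightarrow> 'n::finite state \<Rightarrow> real" where
  "tracking_error xs = (\<lambda>(x, y, c, cb).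
     (norm (x - xs))\<^sup>2 + (norm (y - replicate_profile x))\<^sup>2)"

lemma lyapunov_nonneg: "lyapunov xs cs p \<ge> 0"
  by (cases p) (simp add: lyapunov_def)

text \<open>Together with the next lemma: the square root of the Lyapunov function is equivalent to the
  distance from the equilibrium with gains \<open>cs\<close>. Hence its monotonicity gives boundedness and
  Lyapunov stability simultaneously.\<close>

lemma norm_diff_equilibrium_le:
  "norm (p - equilibrium_state xs cs) \<le> (2 * CARD('n) + 8) * sqrt (lyapunov xs cs (p :: 'n::finite state))"
proof -
  obtain x y c cb where p: "p = (x, y, c, cb)" by (cases p)
  let ?V = "lyapunov xs cs p" and ?e = "y - replicate_profile x"
  let ?C = "(\<chi> i j. cs) :: real ^ 'n ^ 'n"
  have V: "?V = (norm (x - xs))\<^sup>2 / 2 + (norm ?e)\<^sup>2 / 2 + (norm (c - ?C))\<^sup>2 / 4 + (norm (cb - ?C))\<^sup>2 / 2"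
    by (simp add: p lyapunov_def power2_norm_eq_inner)
  have root: "r \<le> 2 * sqrt ?V" if "r\<^sup>2 \<le> 4 * ?V" for r
    using real_le_rsqrt[OF that] by (simp add: real_sqrt_mult)
  have parts: "norm (x - xs) \<le> 2 * sqrt ?V" "norm ?e \<le> 2 * sqrt ?V"
    "norm (c - ?C) \<le> 2 * sqrt ?V" "norm (cb - ?C) \<le> 2 * sqrt ?V"
    by (intro root; simp add: V field_simps)+
  have "norm (y - replicate_profile xs) \<le> norm ?e + norm (replicate_profile (x - xs))"
    using norm_triangle_ineq[of ?e "replicate_profile (x - xs)"]
    by (simp add: replicate_profile_diff)
  also have "\<dots> \<le> 2 * sqrt ?V + CARD('n) * (2 * sqrt ?V)"
    by (intro add_mono parts order_trans[OF norm_replicate_profile_le] mult_left_mono) simp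
  finally have y: "norm (y - replicate_profile xs) \<le> 2 * sqrt ?V + CARD('n) * (2 * sqrt ?V)" .
  have "norm (p - equilibrium_state xs cs) \<le> norm (x - xs) + (norm (y - replicate_profile xs)
      + (norm (c - ?C) + norm (cb - ?C)))"
    unfolding p equilibrium_state_def
    by (simp, intro order_trans[OF norm_Pair_le] add_left_mono) simp
  also have "\<dots> \<le> (2 * CARD('n) + 8) * sqrt ?V"
    using parts y by (simp add: algebra_simps)
  finally show ?thesis .
qed

lemma sqrt_lyapunov_le:
  "sqrt (lyapunov xs cs (p :: 'n::finite state)) \<le> (CARD('n) + 2) * norm (p - equilibrium_state xs cs)"
proof -
  obtain x y c cb where p: "p = (x, y, c, cb)" by (cases p)
  let ?V = "lyapunov xs cs p" and ?e = "y - replicate_profile x"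
  let ?C = "(\<chi> i j. cs) :: real ^ 'n ^ 'n"
  define r where "r = norm (p - equilibrium_state xs cs)"
  have V: "?V = (norm (x - xs))\<^sup>2 / 2 + (norm ?e)\<^sup>2 / 2 + (norm (c - ?C))\<^sup>2 / 4 + (norm (cb - ?C))\<^sup>2 / 2"
    by (simp add: p lyapunov_def power2_norm_eq_inner)
  have pe: "p - equilibrium_state xs cs = (x - xs, y - replicate_profile xs, c - ?C, cb - ?C)"
    by (simp add: p equilibrium_state_def)
  have parts: "norm (x - xs) \<le> r" "norm (y - replicate_profile xs) \<le> r"
    "norm (c - ?C) \<le> r" "norm (cb - ?C) \<le> r"
    unfolding r_def pe
    by (rule norm_fst_le order_trans[OF norm_fst_le norm_snd_le]
        order_trans[OF order_trans[OF norm_fst_le norm_snd_le] norm_snd_le]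
        order_trans[OF order_trans[OF norm_snd_le norm_snd_le] norm_snd_le])+
  have "norm ?e \<le> norm (y - replicate_profile xs) + norm (replicate_profile (x - xs))"
    using norm_triangle_ineq4[of "y - replicate_profile xs" "replicate_profile (x - xs)"]
    by (simp add: replicate_profile_diff)
  also have "\<dots> \<le> r + CARD('n) * r"
    by (intro add_mono parts order_trans[OF norm_replicate_profile_le] mult_left_mono) simp
  finally have e: "norm ?e \<le> (CARD('n) + 1) * r" by (simp add: algebra_simps)
  have sq: "(norm (x - xs))\<^sup>2 \<le> r\<^sup>2" "(norm ?e)\<^sup>2 \<le> ((CARD('n) + 1) * r)\<^sup>2"
    "(norm (c - ?C))\<^sup>2 \<le> r\<^sup>2" "(norm (cb - ?C))\<^sup>2 \<le> r\<^sup>2"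
    using parts e by (intro power_mono; simp)+
  have "r\<^sup>2 * 2 + ((CARD('n) + 1) * r)\<^sup>2 \<le> ((CARD('n) + 2) * r)\<^sup>2"
  proof -
    have "2 + (real CARD('n) + 1)\<^sup>2 \<le> (real CARD('n) + 2)\<^sup>2"
      by (simp add: power2_eq_square algebra_simps)
    then have "(2 + (real CARD('n) + 1)\<^sup>2) * r\<^sup>2 \<le> (real CARD('n) + 2)\<^sup>2 * r\<^sup>2"
      by (rule mult_right_mono) simp
    then show ?thesis unfolding power_mult_distrib by (simp add: algebra_simps)
  qed
  then have "?V \<le> ((CARD('n) + 2) * r)\<^sup>2"
    unfolding V using sq zero_le_power2[of r] zero_le_power2[of "norm ?e"] by linarith
  then show ?thesis unfolding r_def by (intro real_le_lsqrt) auto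
qed

definition estimation_error :: "'n::finite state \<Rightarrow> real ^ 'n ^ 'n" where
  "estimation_error p = fst (snd p) - replicate_profile (fst p)"

lemma bounded_linear_estimation_error: "bounded_linear estimation_error"
  by (auto intro!: linearI
      simp: linear_conv_bounded_linear[symmetric] estimation_error_def replicate_profile_def vec_eq_iff algebra_simps)

lemma lyapunov_has_derivative:
  assumes "(z has_vector_derivative (X, Y, C, D)) (at t within S)" "z t = (x, y, c, cb)"
  shows "((\<lambda>t. lyapunov xs cs (z t)) has_real_derivative
     (x - xs) \<bullet> X + (y - replicate_profile x) \<bullet> (Y - replicate_profile X)
       + (c - (\<chi> i j. cs)) \<bullet> C / 2 + (cb - (\<chi> i j. cs)) \<bullet> D) (at t within S)"
proof -
  note lin = bounded_linear.has_vector_derivative[OF _ assms(1)]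
  have 1: "((\<lambda>t. fst (z t) - xs) has_vector_derivative X) (at t within S)"
    using lin[OF bounded_linear_fst] by (auto intro!: derivative_eq_intros)
  have 2: "((\<lambda>t. estimation_error (z t)) has_vector_derivative Y - replicate_profile X) (at t within S)"
    using lin[OF bounded_linear_estimation_error] by (simp add: estimation_error_def)
  have 3: "((\<lambda>t. fst (snd (snd (z t))) - (\<chi> i j. cs)) has_vector_derivative C) (at t within S)"
    using lin[OF bounded_linear_fst_comp[OF bounded_linear_snd_comp[OF bounded_linear_snd]]]
    by (auto intro!: derivative_eq_intros)
  have 4: "((\<lambda>t. snd (snd (snd (z t))) - (\<chi> i j. cs)) has_vector_derivative D) (at t within S)"
    using lin[OF bounded_linear_snd_comp[OF bounded_linear_snd_comp[OF bounded_linear_snd]]]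
    by (auto intro!: derivative_eq_intros)
  note * = 1[THEN has_real_derivative_inner_self] 2[THEN has_real_derivative_inner_self]
    3[THEN has_real_derivative_inner_self] 4[THEN has_real_derivative_inner_self]
  have "((\<lambda>t. lyapunov xs cs (z t)) has_real_derivative
      2 * ((fst (z t) - xs) \<bullet> X) / 2
      + 2 * (estimation_error (z t) \<bullet> (Y - replicate_profile X)) / 2
      + 2 * ((fst (snd (snd (z t))) - (\<chi> i j. cs)) \<bullet> C) / 4
      + 2 * ((snd (snd (snd (z t))) - (\<chi> i j. cs)) \<bullet> D) / 2) (at t within S)"
    unfolding lyapunov_def case_prod_beta estimation_error_def[symmetric]
    by (intro DERIV_add DERIV_cdivide *)
  then show ?thesis by (simp add: assms(2) estimation_error_def)
qed

text \<open>The derivative of \<open>tracking_error xs\<close> along the vector field \<open>F\<close>, as a function of the state; it is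
  bounded on bounded sets, which supplies the slope bound for Barbalat's argument.\<close>

definition tracking_error_rate :: "('n state \<Rightarrow> 'n state) \<Rightarrow> real ^ 'n \<Rightarrow> 'n::finite state \<Rightarrow> real" where
  "tracking_error_rate F xs p =
     2 * ((fst p - xs) \<bullet> fst (F p)) + 2 * (estimation_error p \<bullet> estimation_error (F p))"

lemma tracking_error_has_derivative:
  assumes "(z has_vector_derivative F (z t)) (at t within S)"
  shows "((\<lambda>t. tracking_error xs (z t)) has_real_derivative tracking_error_rate F xs (z t)) (at t within S)"
proof -
  note lin = bounded_linear.has_vector_derivative[OF _ assms]
  have "((\<lambda>t. fst (z t) - xs) has_vector_derivative fst (F (z t))) (at t within S)"
    using lin[OF bounded_linear_fst] by (auto intro!: derivative_eq_intros)
  note * = this[THEN has_real_derivative_inner_self]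
    lin[OF bounded_linear_estimation_error, THEN has_real_derivative_inner_self]
  show ?thesis
    unfolding tracking_error_def case_prod_beta estimation_error_def[symmetric]
      tracking_error_rate_def power2_norm_eq_inner
    by (rule derivative_eq_intros * refl)+
qed

lemma lipschitz_on_balls_tracking_error_rate:
  assumes "lipschitz_on_balls F"
  shows "lipschitz_on_balls (tracking_error_rate F xs)"
  unfolding tracking_error_rate_def[abs_def]
  by (intro lipschitz_on_balls_add lipschitz_on_balls_mult lipschitz_on_balls_inner
      lipschitz_on_balls_diff lipschitz_on_balls_const assms
      lipschitz_on_balls_linear_compose[OF bounded_linear_estimation_error assms]
      lipschitz_on_balls_linear_compose[OF bounded_linear_fst assms]
      lipschitz_on_balls_bounded_linear bounded_linear_estimation_error bounded_linear_fst)

text \<open>The rates of \<open>c $ i $ j\<close> and \<open>c $ j $ i\<close> agree, so their difference is a constant of motion.\<close>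

lemma gains_stay_symmetric:
  assumes "sym E" "solves_ivp (seeking_dynamics f E) z0 z S" "z0 \<in> admissible_initial_states"
    and "convex S" "0 \<in> S" "t \<in> S"
  shows "z t \<in> admissible_initial_states"
proof -
  define gap where "gap i j p = fst (snd (snd p)) $ i $ j - fst (snd (snd p)) $ j $ i"
    for i j and p :: "'a state"
  have adm: "p \<in> admissible_initial_states \<longleftrightarrow> (\<forall>i j. gap i j p = 0)" for p
    by (cases p) (auto simp: admissible_initial_states_def gap_def)
  have lin: "bounded_linear (gap i j)" for i j
    by (auto intro!: linearI simp: linear_conv_bounded_linear[symmetric] gap_def algebra_simps)
  have "gap i j (seeking_dynamics f E p) = 0" for i j p
    using adjacency_sym[OF \<open>sym E\<close>, of i j]
    by (simp add: gap_def seeking_dynamics_def case_prod_beta inner_diff_left inner_diff_right inner_commute)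
  then have "((\<lambda>s. gap i j (z s)) has_vector_derivative 0) (at s within S)" if "s \<in> S" for i j s
    using assms(2) that bounded_linear.has_vector_derivative[OF lin, of z] unfolding solves_ivp_def
    by metis
  then have "gap i j (z 0) = gap i j (z t)" for i j
    by (rule has_vector_derivative_zero_imp_constant_on[OF assms(4-6)])
  then show ?thesis using assms(2,3) by (simp add: adm solves_ivp_def)
qed

section \<open>Convergence of the adaptive dynamics\<close>

text \<open>The Nash property enters only as a zero of the pseudo-gradient, and the players share one
  Lipschitz constant, so that the estimates below need no bookkeeping over players.\<close>

locale seeking_game =
  fixes f :: "'n::finite \<Rightarrow> real ^ 'n \<Rightarrow> real" and E :: "('n \<times> 'n) set"
    and xs :: "real ^ 'n" and L m :: real
  assumes card: "CARD('n) \<ge> 2"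
    and sym: "sym E" and connected: "\<And>i j. (i, j) \<in> E\<^sup>*"
    and L_pos: "L > 0" and lipschitz: "\<And>i. L-lipschitz_on UNIV (partial_derivative i (f i))"
    and m_pos: "m > 0"
    and strongly_monotone: "\<And>x z.
      m * (norm (x - z))\<^sup>2 \<le> (x - z) \<bullet> (pseudo_gradient f x - pseudo_gradient f z)"
    and critical: "pseudo_gradient f xs = 0"
begin

abbreviation "dynamics \<equiv> seeking_dynamics f E"

lemma lipschitz_on_balls_dynamics: "lipschitz_on_balls dynamics"
  by (rule lipschitz_on_balls_seeking_dynamics[OF lipschitz])

lemma norm_pseudo_gradient_le: "norm (pseudo_gradient f x) \<le> CARD('n) * L * norm (x - xs)"
proof -
  have "norm (pseudo_gradient f x - pseudo_gradient f xs)
      \<le> (\<Sum>i\<in>UNIV. \<bar>(pseudo_gradient f x - pseudo_gradient f xs) $ i\<bar>)"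
    by (rule norm_le_l1_cart)
  also have "\<dots> \<le> (\<Sum>i\<in>(UNIV::'n set). L * norm (x - xs))"
    using lipschitz_on_normD[OF lipschitz, of x xs]
    by (intro sum_mono) (simp add: pseudo_gradient_def)
  finally show ?thesis by (simp add: critical)
qed

lemma norm_estimated_gradient_diff_le:
  "norm ((\<chi> i. partial_derivative i (f i) (y $ i)) - pseudo_gradient f x)
     \<le> CARD('n) * L * norm (y - replicate_profile x)" (is "norm (?g - _) \<le> _")
proof -
  have "norm (?g - pseudo_gradient f x) \<le> (\<Sum>i\<in>UNIV. \<bar>(?g - pseudo_gradient f x) $ i\<bar>)"
    by (rule norm_le_l1_cart)
  also have "\<dots> \<le> (\<Sum>i\<in>(UNIV::'n set). L * norm (y - replicate_profile x))"
  proof (rule sum_mono)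
    fix i
    have "\<bar>(?g - pseudo_gradient f x) $ i\<bar> \<le> L * norm (y $ i - x)"
      using lipschitz_on_normD[OF lipschitz, of "y $ i" x] by (simp add: pseudo_gradient_def)
    also have "y $ i - x = (y - replicate_profile x) $ i"
      by (simp add: replicate_profile_def)
    also have "L * norm ((y - replicate_profile x) $ i) \<le> L * norm (y - replicate_profile x)"
      using L_pos by (intro mult_left_mono Finite_Cartesian_Product.norm_nth_le) auto
    finally show "\<bar>(?g - pseudo_gradient f x) $ i\<bar> \<le> L * norm (y - replicate_profile x)" .
  qed
  finally show ?thesis by simp
qed

text \<open>With \<open>a\<close> the distance of \<open>x\<close> from the equilibrium and \<open>b\<close> the norm of the estimation error, strong
  monotonicity contributes \<open>- m * a\<^sup>2\<close> and the coupling \<open>- cs * \<kappa> * b\<^sup>2\<close>. The Lipschitz bounds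
  control all remaining terms by multiples of \<open>a * b\<close> and \<open>b\<^sup>2\<close>, which are absorbed when \<open>cs\<close> is
  large. The threshold depends only on the game and the graph, not on the state.\<close>

lemma lyapunov_rate_le:
  obtains c0 where "\<And>cs x y c cb X Y C D. cs \<ge> c0 \<Longrightarrow> dynamics (x, y, c, cb) = (X, Y, C, D) \<Longrightarrow>
    (x, y, c, cb) \<in> admissible_initial_states \<Longrightarrow>
    (x - xs) \<bullet> X + (y - replicate_profile x) \<bullet> (Y - replicate_profile X)
       + (c - (\<chi> i j. cs)) \<bullet> C / 2 + (cb - (\<chi> i j. cs)) \<bullet> D
     \<le> - (m / 2) * tracking_error xs (x, y, c, cb)"
proof -
  obtain \<kappa> where \<kappa>: "\<kappa> > 0" "\<And>e :: real ^ 'n ^ 'n. \<kappa> * (norm e)\<^sup>2 \<le> disagreement E e"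
    using disagreement_coercive[OF card connected] by blast
  define N where "N = real CARD('n)"
  have N: "N \<ge> 0" by (simp add: N_def)
  define K where "K = N * L"
  define B where "B = K * (1 + N)"
  \<comment> \<open>The summands pay for the \<open>b\<^sup>2\<close> cross term, for completing the square in \<open>B * (a * b)\<close>, and for the
    dissipation \<open>m / 2 * b\<^sup>2\<close> that is to be kept.\<close>
  define c0 where "c0 = max 0 ((N * K + B\<^sup>2 / (2 * m) + m / 2) / \<kappa>)"
  show ?thesis
  proof (rule that[of c0])
    fix cs x y c cb X Y C D
    assume cs: "cs \<ge> c0" and F: "dynamics (x, y, c, cb) = (X, Y, C, D)"
      and adm: "(x, y, c, cb) \<in> admissible_initial_states"
    define e where "e = y - replicate_profile x"
    define a where "a = norm (x - xs)"
    define b where "b = norm e"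
    define g where "g = (\<chi> i. partial_derivative i (f i) (y $ i))"
    define P where "P = pseudo_gradient f x"
    have X: "X = - g" using F by (auto simp: seeking_dynamics_def g_def vec_eq_iff)
    have gP: "norm (g - P) \<le> K * b"
      using norm_estimated_gradient_diff_le[of y x] by (simp add: g_def P_def K_def N_def b_def e_def)
    have P: "norm P \<le> K * a"
      using norm_pseudo_gradient_le[of x] by (simp add: P_def K_def N_def a_def)
    have g: "norm g \<le> K * b + K * a"
      using norm_triangle_ineq[of "g - P" P] gP P by simp
    have "(x - xs) \<bullet> X = - ((x - xs) \<bullet> P) - (x - xs) \<bullet> (g - P)"
      by (simp add: X inner_diff_right)
    also have "\<dots> \<le> - (m * a\<^sup>2) + a * (K * b)"
    proof -
      have "m * a\<^sup>2 \<le> (x - xs) \<bullet> P"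
        using strongly_monotone[of x xs] by (simp add: critical a_def P_def)
      moreover have "\<bar>(x - xs) \<bullet> (g - P)\<bar> \<le> a * (K * b)"
        unfolding a_def by (rule order_trans[OF Cauchy_Schwarz_ineq2 mult_left_mono[OF gP]]) simp
      ultimately show ?thesis by linarith
    qed
    finally have 1: "(x - xs) \<bullet> X \<le> - (m * a\<^sup>2) + K * (a * b)" by (simp add: mult_ac)
    have "\<bar>e \<bullet> replicate_profile X\<bar> \<le> b * norm (replicate_profile X)"
      unfolding b_def by (rule Cauchy_Schwarz_ineq2)
    also have "\<dots> \<le> b * (N * (K * b + K * a))"
      using N g unfolding N_def
      by (intro mult_left_mono order_trans[OF norm_replicate_profile_le]) (auto simp: X b_def)
    finally have 2: "- (e \<bullet> replicate_profile X) \<le> N * K * b\<^sup>2 + N * K * (a * b)"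
      by (simp add: algebra_simps power2_eq_square)
    have 3: "e \<bullet> Y + (c - (\<chi> i j. cs)) \<bullet> C / 2 + (cb - (\<chi> i j. cs)) \<bullet> D = - cs * disagreement E e"
      using adm by (intro coupling_power[OF F sym]) (auto simp: admissible_initial_states_def e_def)
    have "(N * K + B\<^sup>2 / (2 * m) + m / 2) / \<kappa> \<le> cs" "0 \<le> cs" using cs by (auto simp: c0_def)
    then have "N * K + B\<^sup>2 / (2 * m) + m / 2 \<le> cs * \<kappa>" using \<kappa>(1) by (simp add: pos_divide_le_eq)
    then have "(N * K + B\<^sup>2 / (2 * m) + m / 2) * b\<^sup>2 \<le> cs * \<kappa> * b\<^sup>2"
      by (rule mult_right_mono) simp
    also have "\<dots> \<le> cs * disagreement E e"
      using mult_left_mono[OF \<kappa>(2)[of e] \<open>0 \<le> cs\<close>] by (simp add: b_def mult.assoc)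
    finally have 4: "N * K * b\<^sup>2 + B\<^sup>2 / (2 * m) * b\<^sup>2 + m / 2 * b\<^sup>2 \<le> cs * disagreement E e"
      by (simp add: algebra_simps)
    have "0 \<le> (m * a - B * b)\<^sup>2 / (2 * m)" using m_pos by simp
    also have "\<dots> = m / 2 * a\<^sup>2 - B * (a * b) + B\<^sup>2 / (2 * m) * b\<^sup>2"
      using m_pos by (simp add: field_simps power2_eq_square)
    finally have 5: "B * (a * b) \<le> m / 2 * a\<^sup>2 + B\<^sup>2 / (2 * m) * b\<^sup>2" by simp
    have 6: "B * (a * b) = K * (a * b) + N * K * (a * b)"
      by (simp add: B_def algebra_simps)
    have "(x - xs) \<bullet> X + e \<bullet> (Y - replicate_profile X)
        + (c - (\<chi> i j. cs)) \<bullet> C / 2 + (cb - (\<chi> i j. cs)) \<bullet> D \<le> - (m / 2 * a\<^sup>2) - m / 2 * b\<^sup>2"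
      using 1 2 3 4 5 6 unfolding inner_diff_right[of e] by linarith
    also have "\<dots> = - (m / 2) * tracking_error xs (x, y, c, cb)"
      by (simp add: tracking_error_def a_def b_def e_def algebra_simps)
    finally show "(x - xs) \<bullet> X + (y - replicate_profile x) \<bullet> (Y - replicate_profile X)
       + (c - (\<chi> i j. cs)) \<bullet> C / 2 + (cb - (\<chi> i j. cs)) \<bullet> D
     \<le> - (m / 2) * tracking_error xs (x, y, c, cb)"
      unfolding e_def .
  qed
qed

lemma lyapunov_dissipation:
  obtains c0 where "\<And>cs z0 z S t. cs \<ge> c0 \<Longrightarrow> solves_ivp dynamics z0 z S \<Longrightarrow>
    z0 \<in> admissible_initial_states \<Longrightarrow> convex S \<Longrightarrow> 0 \<in> S \<Longrightarrow> t \<in> S \<Longrightarrow>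
    \<exists>r \<le> - (m / 2) * tracking_error xs (z t).
      ((\<lambda>t. lyapunov xs cs (z t)) has_real_derivative r) (at t within S)"
proof -
  obtain c0 where c0: "\<And>cs x y c cb X Y C D. cs \<ge> c0 \<Longrightarrow> dynamics (x, y, c, cb) = (X, Y, C, D) \<Longrightarrow>
    (x, y, c, cb) \<in> admissible_initial_states \<Longrightarrow>
    (x - xs) \<bullet> X + (y - replicate_profile x) \<bullet> (Y - replicate_profile X)
       + (c - (\<chi> i j. cs)) \<bullet> C / 2 + (cb - (\<chi> i j. cs)) \<bullet> D
     \<le> - (m / 2) * tracking_error xs (x, y, c, cb)"
    by (rule lyapunov_rate_le) blast
  show ?thesis
  proof (rule that[of c0])
    fix cs z0 z S t
    assume cs: "cs \<ge> c0" and z: "solves_ivp dynamics z0 z S" and "z0 \<in> admissible_initial_states"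
      and "convex S" "0 \<in> S" and t: "t \<in> S"
    then have adm: "z t \<in> admissible_initial_states" by (intro gains_stay_symmetric[OF sym z])
    obtain x y c cb where zt: "z t = (x, y, c, cb)" by (cases "z t")
    obtain X Y C D where F: "dynamics (x, y, c, cb) = (X, Y, C, D)" by (cases "dynamics (x, y, c, cb)")
    have "(z has_vector_derivative (X, Y, C, D)) (at t within S)"
      using z t unfolding solves_ivp_def F[symmetric] zt[symmetric] by blast
    from lyapunov_has_derivative[OF this zt] c0[OF cs F] adm
    show "\<exists>r \<le> - (m / 2) * tracking_error xs (z t).
      ((\<lambda>t. lyapunov xs cs (z t)) has_real_derivative r) (at t within S)"
      unfolding zt by blast
  qed
qed

lemma tracking_error_nonneg: "tracking_error xs p \<ge> 0"
  by (cases p) (simp add: tracking_error_def)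

lemma a_priori_bound:
  obtains K c0 where "K > 0"
    "\<And>cs z0 z T. cs \<ge> c0 \<Longrightarrow> solves_ivp dynamics z0 z {0..T} \<Longrightarrow>
      z0 \<in> admissible_initial_states \<Longrightarrow> T \<ge> 0 \<Longrightarrow>
      norm (z T - equilibrium_state xs cs) \<le> K * norm (z0 - equilibrium_state xs cs)"
proof -
  obtain c0 where c0: "\<And>cs z0 z S t. cs \<ge> c0 \<Longrightarrow> solves_ivp dynamics z0 z S \<Longrightarrow>
    z0 \<in> admissible_initial_states \<Longrightarrow> convex S \<Longrightarrow> 0 \<in> S \<Longrightarrow> t \<in> S \<Longrightarrow>
    \<exists>r \<le> - (m / 2) * tracking_error xs (z t).
      ((\<lambda>t. lyapunov xs cs (z t)) has_real_derivative r) (at t within S)"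
    by (rule lyapunov_dissipation) blast
  define K where "K = real (2 * CARD('n) + 8) * real (CARD('n) + 2)"
  show ?thesis
  proof (rule that[of K c0])
    show "K > 0" by (simp add: K_def)
    fix cs z0 z and T :: real
    assume cs: "cs \<ge> c0" and z: "solves_ivp dynamics z0 z {0..T}"
      and z0: "z0 \<in> admissible_initial_states" and T: "T \<ge> 0"
    let ?V = "\<lambda>t. lyapunov xs cs (z t)"
    have "\<forall>t\<in>{0..T}. \<exists>r. r \<le> - (m / 2) * tracking_error xs (z t) \<and>
        (?V has_real_derivative r) (at t within {0..T})"
      using c0[OF cs z z0] T by auto
    then obtain r where r: "\<And>t. t \<in> {0..T} \<Longrightarrow> r t \<le> - (m / 2) * tracking_error xs (z t)"
      "\<And>t. t \<in> {0..T} \<Longrightarrow> (?V has_real_derivative r t) (at t within {0..T})"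
      by metis
    have "?V T - ?V 0 \<le> 0 * (T - 0)"
    proof (rule increment_le_of_derivative_le[OF T r(2)])
      fix t assume "t \<in> {0..T}"
      then have "r t \<le> - (m / 2 * tracking_error xs (z t))" using r(1)[of t] by simp
      moreover have "0 \<le> m / 2 * tracking_error xs (z t)" using m_pos tracking_error_nonneg by simp
      ultimately show "r t \<le> 0" by linarith
    qed
    then have "sqrt (?V T) \<le> sqrt (lyapunov xs cs z0)" using z by (simp add: solves_ivp_def)
    also have "\<dots> \<le> (CARD('n) + 2) * norm (z0 - equilibrium_state xs cs)"
      by (rule sqrt_lyapunov_le)
    finally have "(2 * CARD('n) + 8) * sqrt (?V T) \<le> (2 * CARD('n) + 8) * ((CARD('n) + 2) * norm (z0 - equilibrium_state xs cs))"
      by (rule mult_left_mono) simp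
    with norm_diff_equilibrium_le[of "z T" xs cs]
    have "norm (z T - equilibrium_state xs cs)
        \<le> (2 * CARD('n) + 8) * ((CARD('n) + 2) * norm (z0 - equilibrium_state xs cs))"
      by (rule order_trans)
    then show "norm (z T - equilibrium_state xs cs) \<le> K * norm (z0 - equilibrium_state xs cs)"
      by (simp only: K_def mult.assoc)
  qed
qed

text \<open>The constant \<open>cs\<close> belongs to the Lyapunov function and not to the dynamics, so a single choice
  \<open>cs = c0\<close> bounds the solutions from all admissible initial states, whatever their gains are.\<close>

lemma global_solution:
  assumes "z0 \<in> admissible_initial_states"
  obtains z where "is_global_solution dynamics z0 z"
proof -
  obtain K c0 where K: "\<And>cs z0 z T. cs \<ge> c0 \<Longrightarrow> solves_ivp dynamics z0 z {0..T} \<Longrightarrow>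
      z0 \<in> admissible_initial_states \<Longrightarrow> T \<ge> 0 \<Longrightarrow>
      norm (z T - equilibrium_state xs cs) \<le> K * norm (z0 - equilibrium_state xs cs)"
    by (rule a_priori_bound) blast
  let ?p = "equilibrium_state xs c0"
  have "norm (z T) \<le> norm ?p + K * norm (z0 - ?p)" if "T \<ge> 0" "solves_ivp dynamics z0 z {0..T}" for T z
    using K[OF order_refl that(2) assms that(1)] norm_triangle_ineq[of "z T - ?p" ?p] by simp
  then show ?thesis
    using global_solution_of_a_priori_bound[OF lipschitz_on_balls_dynamics] that by blast
qed

lemma dynamics_equilibrium_state: "dynamics (equilibrium_state xs cs) = 0"
  using critical
  by (auto simp: seeking_dynamics_def equilibrium_state_def replicate_profile_def
      pseudo_gradient_def vec_eq_iff zero_prod_def)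

lemma eventually_lyapunov_stable:
  "\<forall>\<^sub>F cs in at_top. lyapunov_stable dynamics admissible_initial_states (equilibrium_state xs cs)"
proof -
  obtain K c0 where K: "K > 0" "\<And>cs z0 z T. cs \<ge> c0 \<Longrightarrow> solves_ivp dynamics z0 z {0..T} \<Longrightarrow>
      z0 \<in> admissible_initial_states \<Longrightarrow> T \<ge> 0 \<Longrightarrow>
      norm (z T - equilibrium_state xs cs) \<le> K * norm (z0 - equilibrium_state xs cs)"
    by (rule a_priori_bound) blast
  have "lyapunov_stable dynamics admissible_initial_states (equilibrium_state xs cs)" if cs: "cs \<ge> c0" for cs
    unfolding lyapunov_stable_def
  proof (intro conjI dynamics_equilibrium_state allI impI)
    let ?p = "equilibrium_state xs cs"
    fix \<epsilon> :: real assume "\<epsilon> > 0"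
    show "\<exists>\<delta>>0. \<forall>z0\<in>admissible_initial_states. norm (z0 - ?p) < \<delta> \<longrightarrow>
        (\<exists>z. is_global_solution dynamics z0 z \<and> (\<forall>t\<ge>0. norm (z t - ?p) < \<epsilon>))"
    proof (intro exI[of _ "\<epsilon> / K"] conjI ballI impI)
      show "\<epsilon> / K > 0" using \<open>\<epsilon> > 0\<close> K(1) by simp
      fix z0 :: "'n state" assume z0: "z0 \<in> admissible_initial_states" and close: "norm (z0 - ?p) < \<epsilon> / K"
      obtain z where z: "is_global_solution dynamics z0 z" using z0 by (rule global_solution)
      have "norm (z t - ?p) < \<epsilon>" if "t \<ge> 0" for t
      proof -
        have "solves_ivp dynamics z0 z {0..t}"
          using z by (auto simp: is_global_solution_def intro: solves_ivp_subset)
        then have "norm (z t - ?p) \<le> K * norm (z0 - ?p)" by (rule K(2)[OF cs _ z0 that])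
        also have "\<dots> < \<epsilon>" using close K(1) by (simp add: pos_less_divide_eq mult.commute)
        finally show ?thesis .
      qed
      then show "\<exists>z. is_global_solution dynamics z0 z \<and> (\<forall>t\<ge>0. norm (z t - ?p) < \<epsilon>)"
        using z by blast
    qed
  qed
  then show ?thesis by (rule eventually_at_top_linorderI)
qed

lemma solution_bounded:
  assumes "solves_ivp dynamics z0 z {0..}" "z0 \<in> admissible_initial_states"
  obtains R where "\<And>t. t \<ge> 0 \<Longrightarrow> norm (z t) \<le> R"
proof -
  obtain K c0 where K: "\<And>cs z0 z T. cs \<ge> c0 \<Longrightarrow> solves_ivp dynamics z0 z {0..T} \<Longrightarrow>
      z0 \<in> admissible_initial_states \<Longrightarrow> T \<ge> 0 \<Longrightarrow>
      norm (z T - equilibrium_state xs cs) \<le> K * norm (z0 - equilibrium_state xs cs)"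
    by (rule a_priori_bound) blast
  let ?p = "equilibrium_state xs c0"
  have "norm (z t) \<le> norm ?p + K * norm (z0 - ?p)" if "t \<ge> 0" for t
    using K[OF order_refl solves_ivp_subset[OF assms(1), of "{0..t}"] assms(2) that]
      norm_triangle_ineq[of "z t - ?p" ?p] by auto
  then show ?thesis by (rule that)
qed

lemma tracking_error_tendsto_zero:
  assumes z: "solves_ivp dynamics z0 z {0..}" and z0: "z0 \<in> admissible_initial_states"
  shows "((\<lambda>t. tracking_error xs (z t)) \<longlongrightarrow> 0) at_top"
proof -
  obtain c0 where c0: "\<And>cs z0 z S t. cs \<ge> c0 \<Longrightarrow> solves_ivp dynamics z0 z S \<Longrightarrow>
    z0 \<in> admissible_initial_states \<Longrightarrow> convex S \<Longrightarrow> 0 \<in> S \<Longrightarrow> t \<in> S \<Longrightarrow>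
    \<exists>r \<le> - (m / 2) * tracking_error xs (z t).
      ((\<lambda>t. lyapunov xs cs (z t)) has_real_derivative r) (at t within S)"
    by (rule lyapunov_dissipation) blast
  have "\<forall>t\<in>{0..}. \<exists>r. r \<le> - (m / 2) * tracking_error xs (z t) \<and>
      ((\<lambda>t. lyapunov xs c0 (z t)) has_real_derivative r) (at t within {0..})"
    using c0[OF order_refl z z0] by auto
  then obtain V' where "\<forall>t\<in>{0..}. V' t \<le> - (m / 2) * tracking_error xs (z t) \<and>
      ((\<lambda>t. lyapunov xs c0 (z t)) has_real_derivative V' t) (at t within {0..})"
    by (rule bchoice[THEN exE])
  then have V': "\<And>t. t \<ge> 0 \<Longrightarrow> V' t \<le> - (m / 2) * tracking_error xs (z t)"
    "\<And>t. t \<ge> 0 \<Longrightarrow> ((\<lambda>t. lyapunov xs c0 (z t)) has_real_derivative V' t) (at t within {0..})"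
    by simp_all
  obtain R where R: "\<And>t. t \<ge> 0 \<Longrightarrow> norm (z t) \<le> R" by (rule solution_bounded[OF z z0]) blast
  obtain M where M: "M > 0" "\<And>p. norm p \<le> R \<Longrightarrow> norm (tracking_error_rate dynamics xs p) \<le> M"
    by (rule lipschitz_on_balls_bounded[OF
          lipschitz_on_balls_tracking_error_rate[OF lipschitz_on_balls_dynamics]]) blast
  show ?thesis
  proof (rule tendsto_zero_of_dissipation[where k = "m / 2" and M = M
        and V = "\<lambda>t. lyapunov xs c0 (z t)" and V' = V'
        and u' = "\<lambda>t. tracking_error_rate dynamics xs (z t)"])
    fix t :: real assume t: "t \<ge> 0"
    then show "((\<lambda>t. tracking_error xs (z t)) has_real_derivative
        tracking_error_rate dynamics xs (z t)) (at t within {0..})"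
      using z by (intro tracking_error_has_derivative) (simp add: solves_ivp_def)
    show "- M \<le> tracking_error_rate dynamics xs (z t)" using M(2)[OF R[OF t]] by simp
  qed (use m_pos M(1) V' lyapunov_nonneg tracking_error_nonneg in simp_all)
qed

lemma solution_tendsto:
  assumes "solves_ivp dynamics z0 z {0..}" "z0 \<in> admissible_initial_states"
  shows "((\<lambda>t. fst (z t)) \<longlongrightarrow> xs) at_top"
    and "((\<lambda>t. norm (estimation_error (z t))) \<longlongrightarrow> 0) at_top"
proof -
  have root: "((\<lambda>t. sqrt (tracking_error xs (z t))) \<longlongrightarrow> 0) at_top"
    using tendsto_real_sqrt[OF tracking_error_tendsto_zero[OF assms]] by simp
  have "norm (fst (z t) - xs) \<le> sqrt (tracking_error xs (z t))"
    and e: "norm (estimation_error (z t)) \<le> sqrt (tracking_error xs (z t))" for t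
    by (intro real_le_rsqrt; simp add: tracking_error_def case_prod_beta estimation_error_def)+
  then show "((\<lambda>t. fst (z t)) \<longlongrightarrow> xs) at_top"
    by (intro LIM_zero_cancel[OF Lim_null_comparison[OF always_eventually root]]) simp
  show "((\<lambda>t. norm (estimation_error (z t))) \<longlongrightarrow> 0) at_top"
    using e by (intro Lim_null_comparison[OF always_eventually root]) simp
qed

text \<open>Each gain is a linear functional of the state whose rate along the field is nonnegative; along a
  bounded solution such a functional is monotone and bounded.\<close>

lemma gains_converge:
  assumes z: "solves_ivp dynamics z0 z {0..}" and z0: "z0 \<in> admissible_initial_states"
  shows "\<exists>l. ((\<lambda>t. fst (snd (snd (z t))) $ i $ j) \<longlongrightarrow> l) at_top"
    and "\<exists>l. ((\<lambda>t. snd (snd (snd (z t))) $ i $ j) \<longlongrightarrow> l) at_top"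
proof -
  obtain R where R: "\<And>t. t \<ge> 0 \<Longrightarrow> norm (z t) \<le> R" by (rule solution_bounded[OF z z0]) blast
  have monotone_converges: "\<exists>l. ((\<lambda>t. G (z t)) \<longlongrightarrow> l) at_top"
    if G: "bounded_linear G" and rate: "\<And>p. G (dynamics p) \<ge> 0" for G :: "'n state \<Rightarrow> real"
  proof -
    have deriv: "((\<lambda>t. - G (z t)) has_real_derivative - G (dynamics (z t))) (at t within {a..b})"
      if "0 \<le> a" "t \<in> {a..b}" for t a b
    proof -
      have "(z has_vector_derivative dynamics (z t)) (at t within {0..})"
        using z that by (simp add: solves_ivp_def)
      from bounded_linear.has_vector_derivative[OF G this]
      have "((\<lambda>t. G (z t)) has_real_derivative G (dynamics (z t))) (at t within {0..})"
        by (simp add: has_real_derivative_iff_has_vector_derivative)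
      then show ?thesis
        by (rule DERIV_minus[OF has_field_derivative_subset]) (use that(1) in auto)
    qed
    have mono: "G (z s) \<le> G (z t)" if "0 \<le> s" "s \<le> t" for s t
    proof -
      have "- G (z t) - - G (z s) \<le> 0 * (t - s)"
        by (rule increment_le_of_derivative_le[OF that(2) deriv[OF that(1)]]) (simp_all add: rate)
      then show ?thesis by simp
    qed
    obtain B where B: "\<And>p. norm p \<le> R \<Longrightarrow> norm (G p) \<le> B"
      using lipschitz_on_balls_bounded[OF lipschitz_on_balls_bounded_linear[OF G]] by metis
    have "G (z t) \<le> B" if "t \<ge> 0" for t using B[OF R[OF that]] by simp
    from mono this obtain l where "((\<lambda>t. G (z t)) \<longlongrightarrow> l) at_top"
      by (rule mono_bounded_converges_at_top)
    then show ?thesis ..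
  qed
  show "\<exists>l. ((\<lambda>t. fst (snd (snd (z t))) $ i $ j) \<longlongrightarrow> l) at_top"
  proof (rule monotone_converges)
    show "bounded_linear (\<lambda>p :: 'n state. fst (snd (snd p)) $ i $ j)"
      by (auto intro!: linearI simp: linear_conv_bounded_linear[symmetric])
  qed (simp add: seeking_dynamics_def case_prod_beta adjacency_nonneg)
  show "\<exists>l. ((\<lambda>t. snd (snd (snd (z t))) $ i $ j) \<longlongrightarrow> l) at_top"
  proof (rule monotone_converges)
    show "bounded_linear (\<lambda>p :: 'n state. snd (snd (snd p)) $ i $ j)"
      by (auto intro!: linearI simp: linear_conv_bounded_linear[symmetric])
  qed (simp add: seeking_dynamics_def case_prod_beta adjacency_nonneg)
qed

end

theorem theorem2:
  fixes f :: "'n::finite \<Rightarrow> real ^ 'n \<Rightarrow> real"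
    and E :: "('n \<times> 'n) set"
    and xs :: "real ^ 'n"
  assumes "CARD('n) \<ge> 2"
    and "\<And>i. twice_continuously_differentiable (f i)"
    and "\<And>i. \<exists>l>0. \<forall>x z.
           norm (partial_derivative i (f i) x - partial_derivative i (f i) z) \<le> l * norm (x - z)"
    and "\<exists>m>0. \<forall>x z.
           (x - z) \<bullet> (pseudo_gradient f x - pseudo_gradient f z) \<ge> m * (norm (x - z))\<^sup>2"
    and "sym E" and "irrefl E" and "\<And>i j. (i, j) \<in> E\<^sup>*"
    and "nash_equilibrium f xs"
  shows "globally_asymptotically_stable f E xs \<and>
    (\<forall>z0\<in>admissible_initial_states. \<forall>x y c cb.
       solves_ivp (seeking_dynamics f E) z0 (\<lambda>t. (x t, y t, c t, cb t)) {0..} \<longrightarrow>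
       ((\<lambda>t. norm (y t - replicate_profile (x t))) \<longlongrightarrow> 0) at_top) \<and>
    (\<forall>z0\<in>admissible_initial_states. \<forall>x y c cb.
       solves_ivp (seeking_dynamics f E) z0 (\<lambda>t. (x t, y t, c t, cb t)) {0..} \<longrightarrow>
       (\<forall>i j. (\<exists>l. ((\<lambda>t. c t $ i $ j) \<longlongrightarrow> l) at_top) \<and>
              (\<exists>l. ((\<lambda>t. cb t $ i $ j) \<longlongrightarrow> l) at_top)))"
proof -
  obtain l where l: "\<And>i. l i > 0" "\<And>i x z.
      norm (partial_derivative i (f i) x - partial_derivative i (f i) z) \<le> l i * norm (x - z)"
    using assms(3) by metis
  obtain m where m: "m > 0" "\<And>x z.
      m * (norm (x - z))\<^sup>2 \<le> (x - z) \<bullet> (pseudo_gradient f x - pseudo_gradient f z)"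
    using assms(4) by auto
  define L where "L = (\<Sum>i\<in>UNIV. l i)"
  have l_le: "l i \<le> L" for i
    unfolding L_def using l(1) by (intro member_le_sum) (auto intro: less_imp_le)
  interpret seeking_game f E xs L m
  proof
    show "L > 0" using l(1) l_le by (meson less_le_trans)
    show "L-lipschitz_on UNIV (partial_derivative i (f i))" for i
    proof (rule lipschitz_on_mono)
      show "(l i)-lipschitz_on UNIV (partial_derivative i (f i))"
        using l(1)[of i] l(2)[of i] by (intro lipschitz_onI) (auto simp: dist_norm intro: less_imp_le)
    qed (use l_le in auto)
    show "pseudo_gradient f xs = 0"
      using nash_equilibrium_partial_derivative_eq_0[OF assms(2,8)]
      by (simp add: pseudo_gradient_def vec_eq_iff)
  qed (use assms m in auto)
  have "\<exists>z. is_global_solution dynamics z0 z \<and> ((\<lambda>t. fst (z t)) \<longlongrightarrow> xs) at_top"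
    if "z0 \<in> admissible_initial_states" for z0
    using global_solution[OF that] solution_tendsto(1)[OF _ that]
    unfolding is_global_solution_def by metis
  then have "globally_asymptotically_stable f E xs"
    using eventually_lyapunov_stable by (simp add: globally_asymptotically_stable_def)
  moreover have "((\<lambda>t. norm (y t - replicate_profile (x t))) \<longlongrightarrow> 0) at_top"
    if "z0 \<in> admissible_initial_states" "solves_ivp dynamics z0 (\<lambda>t. (x t, y t, c t, cb t)) {0..}"
    for z0 x y c cb
    using solution_tendsto(2)[OF that(2,1)] by (simp add: estimation_error_def)
  moreover have "(\<exists>l. ((\<lambda>t. c t $ i $ j) \<longlongrightarrow> l) at_top) \<and> (\<exists>l. ((\<lambda>t. cb t $ i $ j) \<longlongrightarrow> l) at_top)"
    if "z0 \<in> admissible_initial_states" "solves_ivp dynamics z0 (\<lambda>t. (x t, y t, c t, cb t)) {0..}"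
    for z0 x y c cb i j
    using gains_converge[OF that(2,1), of i j] by simp
  ultimately show ?thesis by blast
qed

end
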